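(* Let $\mu_\omega$ be the random Moran measures described in the context. For any dimension function $\Phi$, the upper and lower $\Phi$-dimensions $\omega\mapsto\overline{\dim}_\Phi\mu_\omega$ and $\omega\mapsto\underline{\dim}_\Phi\mu_\omega$ are almost surely constant functions of $\omega$ (with values in $[0,\infty]$).
   Context: **Random Moran sets and measures.** Let $(\Omega,\mathcal P)$ be a probability space and fix $0<2A\le B<1$. Let $(a_n(\omega),b_n(\omega),p_n(\omega))$, $n\ge1$, be independent, identically distributed random vectors with values in $\{(x,y,z)\in[0,1]^3: A\le\min(x,y)<x+y\le B\}$ (for a fixed $n$ the three coordinates may be dependent). Assume $\mathbb E(p_n^{-t})<\infty$ and $\mathbb E((1-p_n)^{-t})<\infty$ for some $t>0$ (so almost surely $0<p_n<1$ for all $n$). The Moran interval of step $0$ is $[0,1]$. Each Moran interval $I$ of step $n-1$ has two children, which are Moran intervals of step $n$: the left child is the closed subinterval of $I$ with the same left endpoint and length $a_n(\omega)|I|$, and the right child is the closed subinterval of $I$ with the same right endpoint and length $b_n(\omega)|I|$. Here $|I|$ is the length of $I$. Let $\mathcal C_\omega^{(n)}$ be the union of the $2^n$ Moran intervals of step $n$ and $\mathcal C_\omega=\bigcap_n\mathcal C_\omega^{(n)}$. The random measure $\mu_\omega$ is the Borel probability measure on $\mathcal C_\omega$ with $\mu_\omega([0,1])=1$ such that for every Moran interval $I_N$ of step $N$, its left child has measure $p_{N+1}(\omega)\mu_\omega(I_N)$ and its right child has measure $(1-p_{N+1}(\omega))\mu_\omega(I_N)$. **Dimensions.** A dimension function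 is a map $\Phi:(0,1)\to[0,\infty)$ such that $\Psi(t)=t^{1+\Phi(t)}$ decreases to $0$ as $t$ decreases to $0$ and is doubling: there are $C_1,C_2>0$ with $\Psi(2t)\le C_1\Psi(t)$ for all $0<t<C_2$. For a measure $\mu$, with $B(x,r)$ the open ball of centre $x$ and radius $r$, $\overline{\dim}_\Phi\mu$ is the infimum (equal to $\infty$ if there are none) of those $d$ for which there exist $C_1,C_2>0$ such that $\frac{\mu(B(x,R))}{\mu(B(x,r))}\le C_2\left(\frac Rr\right)^d$ for all $x\in\operatorname{supp}\mu$ and all $0<r<R^{1+\Phi(R)}\le R\le C_1$; and $\underline{\dim}_\Phi\mu$ is the supremum of those $d$ for which there exist $C_1,C_2>0$ such that $\frac{\mu(B(x,R))}{\mu(B(x,r))}\ge C_2\left(\frac Rr\right)^d$ for all $x\in\operatorname{supp}\mu$ and all $0<r<R^{1+\Phi(R)}\le R\le C_1$. *)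

theory Defs
  imports "HOL-Probability.Probability"
begin

text \<open>A Moran interval is encoded by the pair of its left and right endpoints.\<close>

primrec moran_intervals :: "(nat \<Rightarrow> real) \<Rightarrow> (nat \<Rightarrow> real) \<Rightarrow> nat \<Rightarrow> (real \<times> real) set" where
  "moran_intervals a b 0 = {(0, 1)}"
| "moran_intervals a b (Suc n) =
    (\<Union>(l, r)\<in>moran_intervals a b n.
      {(l, l + a (Suc n) * (r - l)), (r - b (Suc n) * (r - l), r)})"

definition moran_set :: "(nat \<Rightarrow> real) \<Rightarrow> (nat \<Rightarrow> real) \<Rightarrow> real set" where
  "moran_set a b = (\<Inter>n. \<Union>(l, r)\<in>moran_intervals a b n. {l..r})"

definition is_moran_measure ::
  "(nat \<Rightarrow> real) \<Rightarrow> (nat \<Rightarrow> real) \<Rightarrow> (nat \<Rightarrow> real) \<Rightarrow> real measure \<Rightarrow> bool" where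
  "is_moran_measure a b p \<mu> \<longleftrightarrow>
    prob_space \<mu> \<and> sets \<mu> = sets borel \<and>
    measure \<mu> (moran_set a b) = 1 \<and> measure \<mu> {0..1} = 1 \<and>
    (\<forall>N. \<forall>(l, r)\<in>moran_intervals a b N.
      measure \<mu> {l..l + a (Suc N) * (r - l)} = p (Suc N) * measure \<mu> {l..r} \<and>
      measure \<mu> {r - b (Suc N) * (r - l)..r} = (1 - p (Suc N)) * measure \<mu> {l..r})"

text \<open>
  The expectation of \<open>X\<close> to the power \<open>-t\<close> for a nonnegative random variable \<open>X\<close>, as a
  value in \<open>[0, \<infinity>]\<close>. In \<open>ennreal\<close> the inverse of \<open>0\<close> is \<open>\<infinity>\<close>, so finiteness forces
  \<open>X > 0\<close> almost surely; the real-valued \<open>X powr (-t)\<close> would be \<open>0\<close> where \<open>X = 0\<close>.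
\<close>

definition neg_moment :: "'w measure \<Rightarrow> ('w \<Rightarrow> real) \<Rightarrow> real \<Rightarrow> ennreal" where
  "neg_moment M X t = (\<integral>\<^sup>+\<omega>. inverse (ennreal (X \<omega> powr t)) \<partial>M)"

text \<open>
  Only the values of \<open>\<Phi>\<close> on the open unit interval matter. This is why \<open>2 * t < 1\<close> below, and
  \<open>R < 1\<close> in the two predicates that follow, are required; since \<open>C2\<close>, respectively \<open>C1\<close>, may
  always be decreased, this does not change the notions.
\<close>

definition dimension_function :: "(real \<Rightarrow> real) \<Rightarrow> bool" where
  "dimension_function \<Phi> \<longleftrightarrow>
    (\<forall>t\<in>{0<..<1}. 0 \<le> \<Phi> t) \<and>
    mono_on {0<..<1} (\<lambda>t. t powr (1 + \<Phi> t)) \<and>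
    ((\<lambda>t. t powr (1 + \<Phi> t)) \<longlongrightarrow> 0) (at_right 0) \<and>
    (\<exists>C1>0. \<exists>C2>0. \<forall>t. 0 < t \<and> t < C2 \<and> 2 * t < 1 \<longrightarrow>
      (2 * t) powr (1 + \<Phi> (2 * t)) \<le> C1 * t powr (1 + \<Phi> t))"

definition measure_support :: "'a::topological_space measure \<Rightarrow> 'a set" where
  "measure_support \<mu> = {x. \<forall>U. open U \<and> x \<in> U \<longrightarrow> emeasure \<mu> U > 0}"

definition upper_Phi_bound ::
  "(real \<Rightarrow> real) \<Rightarrow> 'a::metric_space measure \<Rightarrow> real \<Rightarrow> bool" where
  "upper_Phi_bound \<Phi> \<mu> d \<longleftrightarrow>
    (\<exists>C1>0. \<exists>C2>0. \<forall>x\<in>measure_support \<mu>. \<forall>r R.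
      0 < r \<and> r < R powr (1 + \<Phi> R) \<and> R powr (1 + \<Phi> R) \<le> R \<and> R \<le> C1 \<and> R < 1 \<longrightarrow>
      measure \<mu> (ball x R) / measure \<mu> (ball x r) \<le> C2 * (R / r) powr d)"

definition lower_Phi_bound ::
  "(real \<Rightarrow> real) \<Rightarrow> 'a::metric_space measure \<Rightarrow> real \<Rightarrow> bool" where
  "lower_Phi_bound \<Phi> \<mu> d \<longleftrightarrow>
    (\<exists>C1>0. \<exists>C2>0. \<forall>x\<in>measure_support \<mu>. \<forall>r R.
      0 < r \<and> r < R powr (1 + \<Phi> R) \<and> R powr (1 + \<Phi> R) \<le> R \<and> R \<le> C1 \<and> R < 1 \<longrightarrow>
      measure \<mu> (ball x R) / measure \<mu> (ball x r) \<ge> C2 * (R / r) powr d)"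

definition upper_Phi_dim :: "(real \<Rightarrow> real) \<Rightarrow> 'a::metric_space measure \<Rightarrow> ereal" where
  "upper_Phi_dim \<Phi> \<mu> = Inf (ereal ` {d. upper_Phi_bound \<Phi> \<mu> d})"

definition lower_Phi_dim :: "(real \<Rightarrow> real) \<Rightarrow> 'a::metric_space measure \<Rightarrow> ereal" where
  "lower_Phi_dim \<Phi> \<mu> = Sup (ereal ` {d. lower_Phi_bound \<Phi> \<mu> d})"

end

theory Submission
  imports Defs
begin

text \<open>
  The dimensions do not change when finitely many of the vectors \<open>(a\<^sub>n, b\<^sub>n, p\<^sub>n)\<close> are permuted
  among themselves, so the Hewitt-Savage zero-one law makes them almost surely constant.

  Permutations act well for the following reason. Let \<open>\<pi>\<close> permute the first \<open>m\<close> steps. Lengths and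
  masses of Moran intervals are products over the steps, so below level \<open>m\<close> the permuted
  construction has intervals of the same lengths and masses, and each piece of level \<open>m\<close> is
  translated as a whole. Distinct pieces of level \<open>m\<close> are at least \<open>(1 - B) A\<^sup>m\<close> apart in both
  constructions, so balls of smaller radius have the same mass before and after (lemma
  \<open>ball_mass_permute\<close>), and only small radii matter. Deleting the first steps instead, as for
  the tail \<open>\<sigma>\<close>-algebra, would rescale the intervals and thereby change which pairs \<open>r < R\<close> are
  admissible for \<open>\<Phi>\<close>; permuting them preserves every length.

  The zero-one law needs measurable events, whereas the definitions quantify over all points of the
  support and all scales. Three facts reduce this to countably many conditions. The mass of a ball
  is the limit of the total mass of the level \<open>N\<close> intervals inside it, a measurable function of the
  vectors. The left endpoints of Moran intervals are dense in the support. The measure almost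
  surely has no atoms, because \<open>\<Prod>n\<le>N. max p\<^sub>n (1 - p\<^sub>n)\<close> has expectation \<open>q\<^sup>N\<close> with
  \<open>q < 1\<close>; hence the mass of a ball is continuous in its centre and radius, and a bound on a dense
  set of centres and scales extends to all of them (lemma \<open>coded_bound_iff\<close>).

  Finally, the set of exponents \<open>d\<close> satisfying a bound is upward closed for the upper and downward
  closed for the lower dimension, so the dimension is determined by the truth values for rational
  \<open>d\<close>. Each of these countably many truth values is almost surely constant.
\<close>

section \<open>Permutation-invariant events of an i.i.d. sequence\<close>

definition determined_on :: "'i set \<Rightarrow> ('i \<Rightarrow> 'a) set \<Rightarrow> bool" where
  "determined_on J F \<longleftrightarrow> (\<forall>s t. (\<forall>i\<in>J. s i = t i) \<longrightarrow> (s \<in> F \<longleftrightarrow> t \<in> F))"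

lemma determined_on_mono: "determined_on J F \<Longrightarrow> J \<subseteq> K \<Longrightarrow> determined_on K F"
  unfolding determined_on_def by blast

definition block_swap :: "nat \<Rightarrow> nat \<Rightarrow> nat" where
  "block_swap n i = (if i < n then i + n else if i < 2 * n then i - n else i)"

lemma block_swap_invol: "block_swap n (block_swap n i) = i"
  by (auto simp: block_swap_def)

lemma block_swap_permutes: "block_swap n permutes {..<2 * n}"
  by (rule bij_imp_permutes[OF bij_betwI[where g = "block_swap n"]])
    (auto simp: block_swap_invol, auto simp: block_swap_def)

context
  fixes D :: "'a measure"
  assumes D: "prob_space D" and full: "space D = UNIV"
begin

abbreviation "seq_space \<equiv> PiM (UNIV :: nat set) (\<lambda>_. D)"

lemma space_seq_space: "space seq_space = UNIV"
  by (simp add: space_PiM full)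

lemma prob_space_seq_space: "prob_space seq_space"
  by (intro prob_space_PiM D)

text \<open>
  The measurable set is found by filling in the coordinates outside \<open>J\<close> with an arbitrary constant,
  which does not affect membership.
\<close>
lemma determined_on_vimage_restrict:
  assumes F: "F \<in> sets seq_space" and J: "determined_on J F"
  obtains F' where "F' \<in> sets (PiM J (\<lambda>_. D))" "F = (\<lambda>s. restrict s J) -` F'"
proof
  define ext where "ext = (\<lambda>x i. if i \<in> J then x i else (undefined::'a))"
  have ext: "ext \<in> measurable (PiM J (\<lambda>_. D)) seq_space"
    unfolding ext_def
  proof (rule measurable_PiM_single')
    fix i show "(\<lambda>x. if i \<in> J then x i else undefined) \<in> measurable (PiM J (\<lambda>_. D)) D"
      by (cases "i \<in> J") (auto simp: full)
  qed (auto simp: full)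
  show "ext -` F \<inter> space (PiM J (\<lambda>_. D)) \<in> sets (PiM J (\<lambda>_. D))"
    using ext F by (rule measurable_sets)
  have "s \<in> F \<longleftrightarrow> ext (restrict s J) \<in> F" for s
    using J by (simp add: determined_on_def ext_def)
  then show "F = (\<lambda>s. restrict s J) -` (ext -` F \<inter> space (PiM J (\<lambda>_. D)))"
    by (auto simp: space_PiM full)
qed

lemma prob_Int_determined_on_disjoint:
  assumes F: "F \<in> sets seq_space" "determined_on J F"
    and G: "G \<in> sets seq_space" "determined_on K G" and "J \<inter> K = {}"
  shows "measure seq_space (F \<inter> G) = measure seq_space F * measure seq_space G"
proof -
  interpret prob_space seq_space by (rule prob_space_seq_space)
  have "distr seq_space seq_space (\<lambda>s. \<lambda>i\<in>UNIV. s i) = PiM UNIV (\<lambda>i. distr seq_space D (\<lambda>s. s i))"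
    using distr_PiM_component[of UNIV "\<lambda>_::nat. D"] D by (simp add: restrict_UNIV distr_id)
  then have "indep_vars (\<lambda>_. D) (\<lambda>i s. s i) UNIV"
    by (subst indep_vars_iff_distr_eq_PiM) auto
  then have ind: "indep_var (PiM J (\<lambda>_. D)) (\<lambda>s. restrict (\<lambda>i. s i) J)
      (PiM K (\<lambda>_. D)) (\<lambda>s. restrict (\<lambda>i. s i) K)"
    using \<open>J \<inter> K = {}\<close> by (intro indep_var_restrict) auto
  obtain F' where F': "F' \<in> sets (PiM J (\<lambda>_. D))" "F = (\<lambda>s. restrict s J) -` F'"
    using determined_on_vimage_restrict[OF F] .
  obtain G' where G': "G' \<in> sets (PiM K (\<lambda>_. D))" "G = (\<lambda>s. restrict s K) -` G'"
    using determined_on_vimage_restrict[OF G] .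
  show ?thesis
    using indep_varD[OF ind F'(1) G'(1)] F'(2) G'(2)
    by (simp add: space_seq_space Int_def vimage_def)
qed

text \<open>
  The sets that can be approximated in this way contain the one-coordinate events that generate the
  product \<open>\<sigma>\<close>-algebra and are closed under complement. They are closed under countable unions
  because finitely many members exhaust a union up to small measure, and finitely many approximants
  depend together on finitely many coordinates.
\<close>
lemma approximation_determined_on_finite:
  assumes "E \<in> sets seq_space" "\<epsilon> > 0"
  shows "\<exists>n F. F \<in> sets seq_space \<and> determined_on {..<n} F \<and> measure seq_space (E - F) + measure seq_space (F - E) < \<epsilon>"
proof -
  interpret prob_space seq_space by (rule prob_space_seq_space)
  let ?R = "{{f \<in> \<Pi>\<^sub>E i\<in>UNIV. space D. f i \<in> A} |(i::nat) A. i \<in> UNIV \<and> A \<in> sets D}"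
  have "E \<in> sigma_sets (\<Pi>\<^sub>E i\<in>UNIV. space D) ?R"
    using assms(1) by (simp add: sets_PiM_single)
  then show ?thesis using \<open>\<epsilon> > 0\<close>
  proof (induction arbitrary: \<epsilon>)
    case (Basic E)
    then obtain i A where iA: "A \<in> sets D" "E = {f. f i \<in> A}"
      by (auto simp: full)
    then have "determined_on {..<Suc i} E"
      by (auto simp: determined_on_def)
    moreover have "E \<in> sets seq_space"
      using measurable_sets[of "\<lambda>f. f i" seq_space D A] iA by (simp add: space_seq_space vimage_def)
    ultimately show ?case using \<open>\<epsilon> > 0\<close> by (intro exI[of _ "Suc i"] exI[of _ E]) simp
  next
    case Empty
    then show ?case
      by (intro exI[of _ 0] exI[of _ "{}"]) (simp add: determined_on_def)
  next
    case (Compl E)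
    obtain n F where F: "F \<in> sets seq_space" "determined_on {..<n} F"
      "measure seq_space (E - F) + measure seq_space (F - E) < \<epsilon>"
      using Compl.IH[OF Compl.prems] by blast
    have "(UNIV - E) - (UNIV - F) = F - E" "(UNIV - F) - (UNIV - E) = E - F" by auto
    then have "measure seq_space ((UNIV - E) - (UNIV - F)) + measure seq_space ((UNIV - F) - (UNIV - E)) < \<epsilon>"
      using F(3) by simp
    moreover have "UNIV - F \<in> sets seq_space"
      using sets.compl_sets[OF F(1)] by (simp add: space_seq_space)
    moreover have "determined_on {..<n} (UNIV - F)"
      using F(2) by (simp add: determined_on_def)
    ultimately show ?case by (auto simp: full)
  next
    case (Union E)
    have E: "E i \<in> sets seq_space" for i
      using Union.hyps[of i] by (simp add: sets_PiM_single)
    \<comment> \<open>Half of the error is spent on truncating the union, the other half on \<open>N\<close> approximations.\<close>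
    have "(\<lambda>N. measure seq_space (\<Union>i<N. E i)) \<longlonglongrightarrow> measure seq_space (\<Union>N. \<Union>i<N. E i)"
      using E by (intro finite_Lim_measure_incseq) (auto simp: incseq_def intro: order_less_le_trans)
    moreover have "(\<Union>N. \<Union>i<N. E i) = (\<Union>i. E i)" by auto
    ultimately have "(\<lambda>N. measure seq_space (\<Union>i<N. E i)) \<longlonglongrightarrow> measure seq_space (\<Union>i. E i)" by simp
    moreover have "measure seq_space (\<Union>i. E i) - \<epsilon> / 2 < measure seq_space (\<Union>i. E i)" using Union.prems by simp
    ultimately have "eventually (\<lambda>N. measure seq_space (\<Union>i. E i) - \<epsilon> / 2 < measure seq_space (\<Union>i<N. E i)) sequentially"
      by (rule order_tendstoD)
    then obtain N where N: "measure seq_space (\<Union>i. E i) - \<epsilon> / 2 < measure seq_space (\<Union>i<N. E i)"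
      by (auto simp: eventually_sequentially)
    have tail: "measure seq_space ((\<Union>i. E i) - (\<Union>i<N. E i)) < \<epsilon> / 2"
      using N E by (subst finite_measure_Diff) auto
    define \<delta> where "\<delta> = \<epsilon> / (2 * (real N + 1))"
    have "\<delta> > 0" using Union.prems by (simp add: \<delta>_def)
    then have "\<forall>i. \<exists>n F. F \<in> sets seq_space \<and> determined_on {..<n} F \<and>
        measure seq_space (E i - F) + measure seq_space (F - E i) < \<delta>"
      using Union.IH by blast
    then obtain n F where F: "\<And>i. F i \<in> sets seq_space" "\<And>i. determined_on {..<n i :: nat} (F i)"
      "\<And>i. measure seq_space (E i - F i) + measure seq_space (F i - E i) < \<delta>"
      by metis
    let ?F = "\<Union>i<N. F i"
    define m where "m = (\<Sum>i<N. n i)"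
    have "n i \<le> m" if "i < N" for i
      unfolding m_def using that by (intro member_le_sum) auto
    then have "determined_on {..<m} (F i)" if "i < N" for i
      using that by (intro determined_on_mono[OF F(2)]) auto
    then have det: "determined_on {..<m} ?F"
      unfolding determined_on_def by blast
    have sub1: "measure seq_space ((\<Union>i. E i) - ?F) \<le>
        measure seq_space ((\<Union>i. E i) - (\<Union>i<N. E i)) + (\<Sum>i<N. measure seq_space (E i - F i))"
    proof -
      have "measure seq_space ((\<Union>i. E i) - ?F) \<le>
        measure seq_space (((\<Union>i. E i) - (\<Union>i<N. E i)) \<union> (\<Union>i<N. E i - F i))"
        using E F(1) by (intro finite_measure_mono) auto
      also have "\<dots> \<le> measure seq_space ((\<Union>i. E i) - (\<Union>i<N. E i)) + measure seq_space (\<Union>i<N. E i - F i)"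
        using E F(1) by (intro measure_Un_le) auto
      also have "measure seq_space (\<Union>i<N. E i - F i) \<le> (\<Sum>i<N. measure seq_space (E i - F i))"
        using E F(1) by (intro finite_measure_subadditive_finite) auto
      finally show ?thesis by simp
    qed
    have sub2: "measure seq_space (?F - (\<Union>i. E i)) \<le> (\<Sum>i<N. measure seq_space (F i - E i))"
    proof -
      have "measure seq_space (?F - (\<Union>i. E i)) \<le> measure seq_space (\<Union>i<N. F i - E i)"
        using E F(1) by (intro finite_measure_mono) auto
      also have "\<dots> \<le> (\<Sum>i<N. measure seq_space (F i - E i))"
        using E F(1) by (intro finite_measure_subadditive_finite) auto
      finally show ?thesis .
    qed
    have "(\<Sum>i<N. measure seq_space (E i - F i) + measure seq_space (F i - E i)) \<le> real N * \<delta>"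
      using sum_mono[of "{..<N}" "\<lambda>i. measure seq_space (E i - F i) + measure seq_space (F i - E i)" "\<lambda>_. \<delta>"]
        F(3) less_imp_le by (simp add: less_imp_le)
    also have "\<dots> \<le> \<epsilon> / 2"
      using Union.prems by (simp add: \<delta>_def divide_simps)
    finally have "measure seq_space ((\<Union>i. E i) - ?F) + measure seq_space (?F - (\<Union>i. E i)) < \<epsilon>"
      using sub1 sub2 tail by (simp add: sum.distrib)
    moreover have "?F \<in> sets seq_space" using F(1) by auto
    ultimately show ?case using det by blast
  qed
qed

lemma distr_seq_space_reindex:
  assumes "inj \<pi>"
  shows "distr seq_space seq_space (\<lambda>s. s \<circ> \<pi>) = seq_space"
  using distr_PiM_reindex[of UNIV "\<lambda>_. D" \<pi> UNIV] assms D
  by (simp add: comp_def restrict_UNIV)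

text \<open>
  Approximate \<open>E\<close> by an event \<open>F\<close> of the first \<open>n\<close> coordinates. Swapping these with the next \<open>n\<close>
  coordinates fixes \<open>E\<close> and turns \<open>F\<close> into an independent copy \<open>F'\<close>, which approximates \<open>E\<close> equally
  well. So \<open>P E\<close> is close to \<open>P (F \<inter> F') = (P F)\<^sup>2\<close>, hence to \<open>(P E)\<^sup>2\<close>.
\<close>
theorem hewitt_savage:
  assumes E: "E \<in> sets seq_space"
    and inv: "\<And>n \<pi> s. \<pi> permutes {..<n} \<Longrightarrow> s \<circ> \<pi> \<in> E \<longleftrightarrow> s \<in> E"
  shows "measure seq_space E = 0 \<or> measure seq_space E = 1"
proof -
  interpret prob_space seq_space by (rule prob_space_seq_space)
  have "\<bar>prob E - prob E * prob E\<bar> \<le> 0 + \<epsilon>" if "\<epsilon> > 0" for \<epsilon>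
  proof -
    have "\<epsilon> / 4 > 0" using that by simp
    from approximation_determined_on_finite[OF E this] obtain n F where F: "F \<in> sets seq_space"
      "determined_on {..<n} F" "prob (E - F) + prob (F - E) < \<epsilon> / 4"
      by blast
    let ?g = "\<lambda>s. s \<circ> block_swap n"
    have g: "?g \<in> measurable seq_space seq_space"
      unfolding comp_def by (rule measurable_PiM_single') (auto simp: space_PiM full)
    have inj: "inj (block_swap n)" by (metis block_swap_invol injI)
    have pres: "prob (?g -` A) = prob A" if "A \<in> sets seq_space" for A
      using measure_distr[OF g that] distr_seq_space_reindex[OF inj] by (simp add: space_seq_space)
    define F' where "F' = ?g -` F"
    have F': "F' \<in> sets seq_space"
      using measurable_sets[OF g F(1)] by (simp add: F'_def space_seq_space)
    have invE: "?g -` E = E" using inv[OF block_swap_permutes] by auto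
    have "?g -` (E - F) = E - F'" "?g -` (F - E) = F' - E"
      using invE by (auto simp: F'_def)
    then have close': "prob (E - F') = prob (E - F)" "prob (F' - E) = prob (F - E)"
      using pres[of "E - F"] pres[of "F - E"] E F(1) by auto
    have "determined_on {n..<2*n} F'"
      unfolding determined_on_def
    proof (intro allI impI)
      fix s t :: "nat \<Rightarrow> 'a" assume "\<forall>i\<in>{n..<2*n}. s i = t i"
      then have "\<forall>i\<in>{..<n}. ?g s i = ?g t i" by (auto simp: block_swap_def)
      then show "s \<in> F' \<longleftrightarrow> t \<in> F'"
        using F(2) by (simp add: F'_def determined_on_def)
    qed
    then have indep: "prob (F \<inter> F') = prob F * prob F'"
      using F F' by (intro prob_Int_determined_on_disjoint[where J = "{..<n}" and K = "{n..<2*n}"]) auto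
    have pF': "prob F' = prob F" unfolding F'_def by (rule pres[OF F(1)])
    have diff: "prob (X - Y) = prob X - prob (X \<inter> Y)" if "X \<in> sets seq_space" "Y \<in> sets seq_space" for X Y
      using that by (rule finite_measure_Diff')
    have 1: "\<bar>prob E - prob F\<bar> \<le> \<epsilon> / 4"
      using diff[OF E F(1)] diff[OF F(1) E] F(3) measure_nonneg[of seq_space "E - F"] measure_nonneg[of seq_space "F - E"]
      unfolding Int_commute[of F E] by linarith
    have 2: "\<bar>prob E - prob (F \<inter> F')\<bar> \<le> \<epsilon> / 2"
    proof -
      have "prob E \<le> prob ((F \<inter> F') \<union> ((E - F) \<union> (E - F')))"
        using E F(1) F' by (intro finite_measure_mono) auto
      also have "\<dots> \<le> prob (F \<inter> F') + prob ((E - F) \<union> (E - F'))"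
        using E F(1) F' by (intro measure_Un_le) auto
      also have "prob ((E - F) \<union> (E - F')) \<le> prob (E - F) + prob (E - F')"
        using E F(1) F' by (intro measure_Un_le) auto
      finally have a: "prob E \<le> prob (F \<inter> F') + (prob (E - F) + prob (E - F'))" by simp
      have "prob (F \<inter> F') \<le> prob (E \<union> (F - E))"
        using E F(1) F' by (intro finite_measure_mono) auto
      also have "\<dots> \<le> prob E + prob (F - E)"
        using E F(1) F' by (intro measure_Un_le) auto
      finally show ?thesis
        using a close' F(3) measure_nonneg[of seq_space "E - F"] measure_nonneg[of seq_space "F - E"] by linarith
    qed
    have "\<bar>prob E * prob E - prob F * prob F\<bar> = \<bar>prob E - prob F\<bar> * (prob E + prob F)"
      by (simp add: square_diff_square_factored abs_mult)
    also have "\<dots> \<le> (\<epsilon> / 4) * 2"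
      using 1 add_mono[OF prob_le_1[of E] prob_le_1[of F]] that by (intro mult_mono) auto
    finally show ?thesis using 2 unfolding indep pF' by linarith
  qed
  then have "\<bar>prob E - prob E * prob E\<bar> \<le> 0"
    by (rule field_le_epsilon)
  then have "prob E * (1 - prob E) = 0" by (simp add: algebra_simps)
  then show ?thesis by auto
qed

end

text \<open>
  By independence the joint law of the sequence, renumbered from \<open>0\<close>, is the product measure, to
  which the zero-one law applies. A constant truth value covers both of its alternatives at once.
\<close>
lemma (in prob_space) hewitt_savage_iid:
  fixes X :: "nat \<Rightarrow> 'a \<Rightarrow> 'b"
  assumes indep: "indep_vars (\<lambda>_. N) X {1..}"
    and ident: "\<And>n. n \<ge> 1 \<Longrightarrow> distr M N (X n) = distr M N (X 1)"
    and full: "space N = UNIV" and E: "E \<in> sets (PiM UNIV (\<lambda>_. N))"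
    and inv: "\<And>n \<pi> s. \<pi> permutes {..<n} \<Longrightarrow> s \<circ> \<pi> \<in> E \<longleftrightarrow> s \<in> E"
  shows "\<exists>c. AE \<omega> in M. (\<lambda>i. X (Suc i) \<omega>) \<in> E \<longleftrightarrow> c"
proof -
  define D where "D = distr M N (X 1)"
  have X: "X n \<in> measurable M N" if "n \<ge> 1" for n
    using indep that by (simp add: indep_vars_def)
  then have D: "prob_space D" "space D = UNIV" and sets_D: "sets D = sets N"
    by (simp_all add: D_def prob_space_distr full)
  have sets_S: "sets (PiM UNIV (\<lambda>_::nat. D)) = sets (PiM UNIV (\<lambda>_. N))"
    by (intro sets_PiM_cong sets_D refl)
  let ?Y = "\<lambda>\<omega> i. X (Suc i) \<omega>"
  have Y: "?Y \<in> measurable M (PiM UNIV (\<lambda>_. N))"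
    using X by (intro measurable_PiM_single') (auto simp: full)
  have "distr M (PiM {1..} (\<lambda>_. N)) (\<lambda>\<omega>. \<lambda>i\<in>{1..}. X i \<omega>) = PiM {1..} (\<lambda>i. distr M N (X i))"
    using indep X by (subst indep_vars_iff_distr_eq_PiM'[symmetric]) auto
  also have "\<dots> = PiM {1..} (\<lambda>_. D)"
    unfolding D_def by (rule PiM_cong[OF refl], rule ident) simp
  finally have joint: "distr M (PiM {1..} (\<lambda>_. N)) (\<lambda>\<omega>. \<lambda>i\<in>{1..}. X i \<omega>) = PiM {1..} (\<lambda>_. D)" .
  have shift: "(\<lambda>s n. s (Suc n)) \<in> measurable (PiM {1..} (\<lambda>_. N)) (PiM UNIV (\<lambda>_. N))"
    by (intro measurable_PiM_single' measurable_component_singleton) (auto simp: full)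
  have "PiM UNIV (\<lambda>_. D) = distr (PiM {1..} (\<lambda>_. D)) (PiM UNIV (\<lambda>_. D)) (\<lambda>s. \<lambda>n\<in>UNIV. s (Suc n))"
    using D by (subst distr_PiM_reindex) auto
  also have "\<dots> = distr (PiM {1..} (\<lambda>_. D)) (PiM UNIV (\<lambda>_. N)) (\<lambda>s n. s (Suc n))"
    by (intro distr_cong sets_S) (auto simp: restrict_UNIV)
  also have "\<dots> = distr M (PiM UNIV (\<lambda>_. N)) ((\<lambda>s n. s (Suc n)) \<circ> (\<lambda>\<omega>. \<lambda>i\<in>{1..}. X i \<omega>))"
    unfolding joint[symmetric] using X by (intro distr_distr shift measurable_restrict) auto
  also have "(\<lambda>s n. s (Suc n)) \<circ> (\<lambda>\<omega>. \<lambda>i\<in>{1..}. X i \<omega>) = ?Y"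
    by (simp add: comp_def)
  finally have law: "distr M (PiM UNIV (\<lambda>_. N)) ?Y = PiM UNIV (\<lambda>_. D)" by simp
  have E': "E \<in> sets (PiM UNIV (\<lambda>_. D))" using E sets_S by simp
  have "prob {\<omega> \<in> space M. ?Y \<omega> \<in> E} = measure (PiM UNIV (\<lambda>_. D)) E"
    unfolding law[symmetric] by (subst measure_distr[OF Y E]) (simp add: vimage_def Int_def conj_commute)
  moreover have ev: "{\<omega> \<in> space M. ?Y \<omega> \<in> E} \<in> events"
    using measurable_sets[OF Y E] by (simp add: vimage_def Int_def conj_commute)
  moreover have "measure (PiM UNIV (\<lambda>_. D)) E = 0 \<or> measure (PiM UNIV (\<lambda>_. D)) E = 1"
    by (rule hewitt_savage[OF D E' inv])
  ultimately consider "prob {\<omega> \<in> space M. ?Y \<omega> \<in> E} = 0" | "prob {\<omega> \<in> space M. ?Y \<omega> \<in> E} = 1"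
    by linarith
  then show ?thesis
  proof cases
    case 1
    then have "AE \<omega> in M. \<omega> \<notin> {\<omega> \<in> space M. ?Y \<omega> \<in> E}"
      by (simp only: prob_eq_0[OF ev])
    then have "AE \<omega> in M. ?Y \<omega> \<in> E \<longleftrightarrow> False"
      using AE_space by eventually_elim simp
    then show ?thesis by (rule exI)
  next
    case 2
    then have "AE \<omega> in M. \<omega> \<in> {\<omega> \<in> space M. ?Y \<omega> \<in> E}"
      by (simp only: prob_eq_1[OF ev])
    then have "AE \<omega> in M. ?Y \<omega> \<in> E \<longleftrightarrow> True"
      by eventually_elim simp
    then show ?thesis by (rule exI)
  qed
qed

section \<open>Moran intervals coded by words\<close>

text \<open>
  A set \<open>V\<close> of naturals codes the interval of level \<open>N\<close> that is reached by going right at the steps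
  \<open>i < N\<close> with \<open>i \<in> V\<close> and left at the others; steps are numbered from \<open>0\<close>. Its length is
  \<open>word_prod a b V N\<close> and its mass is \<open>word_prod p (\<lambda>i. 1 - p i) V N\<close>.
\<close>
definition word_prod :: "(nat \<Rightarrow> real) \<Rightarrow> (nat \<Rightarrow> real) \<Rightarrow> nat set \<Rightarrow> nat \<Rightarrow> real" where
  "word_prod f g V N = (\<Prod>i<N. if i \<in> V then g i else f i)"

definition left_end :: "(nat \<Rightarrow> real) \<Rightarrow> (nat \<Rightarrow> real) \<Rightarrow> nat set \<Rightarrow> nat \<Rightarrow> real" where
  "left_end a b V N = (\<Sum>i<N. if i \<in> V then (1 - b i) * word_prod a b V i else 0)"

text \<open>
  The total mass of the level \<open>N\<close> intervals that lie inside the open ball around \<open>x\<close> of radius \<open>r\<close>,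
  and the limit of this mass, are expressed by the ratios and weights alone: this is what makes them
  measurable, and comparable after a permutation, without reference to a measure.
\<close>
definition inner_mass ::
  "(nat \<Rightarrow> real) \<Rightarrow> (nat \<Rightarrow> real) \<Rightarrow> (nat \<Rightarrow> real) \<Rightarrow> real \<Rightarrow> real \<Rightarrow> nat \<Rightarrow> real" where
  "inner_mass a b p x r N = (\<Sum>V\<in>Pow {..<N}.
     if x - r < left_end a b V N \<and> left_end a b V N + word_prod a b V N < x + r
     then word_prod p (\<lambda>i. 1 - p i) V N else 0)"

definition ball_mass ::
  "(nat \<Rightarrow> real) \<Rightarrow> (nat \<Rightarrow> real) \<Rightarrow> (nat \<Rightarrow> real) \<Rightarrow> real \<Rightarrow> real \<Rightarrow> real" where
  "ball_mass a b p x r = lim (inner_mass a b p x r)"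

text \<open>
  The dimension bound over a set \<open>T\<close> of pairs of scales, with centres restricted to left endpoints
  and with constants from countable families. The sign \<open>\<sigma> = 1\<close> gives the upper bound with
  exponent \<open>d\<close>; for \<open>\<sigma> = - 1\<close> both sides are inverted, which gives the lower one. The strict
  inequality \<open>R < 1 / Suc n\<close> is an open condition, so that dense sets of scales suffice.
\<close>
definition coded_bound ::
  "(real \<times> real) set \<Rightarrow> real \<Rightarrow> real \<Rightarrow> (nat \<Rightarrow> real) \<Rightarrow> (nat \<Rightarrow> real) \<Rightarrow> (nat \<Rightarrow> real) \<Rightarrow> bool" where
  "coded_bound T \<sigma> d a b p \<longleftrightarrow>
    (\<exists>n k :: nat. \<forall>(r, R)\<in>T. R < 1 / real (Suc n) \<longrightarrow> (\<forall>K. \<forall>V\<in>Pow {..<K}.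
       (ball_mass a b p (left_end a b V K) R / ball_mass a b p (left_end a b V K) r) powr \<sigma>
         \<le> real (Suc k) * (R / r) powr (\<sigma> * d)))"

definition admissible_scales :: "(real \<Rightarrow> real) \<Rightarrow> (real \<times> real) set" where
  "admissible_scales \<Phi> =
    {(r, R). 0 < r \<and> r < R powr (1 + \<Phi> R) \<and> R powr (1 + \<Phi> R) \<le> R \<and> R < 1}"

lemma ball_admissible_scales:
  "(\<forall>(r, R)\<in>admissible_scales \<Phi>. R \<le> C1 \<longrightarrow> Q r R) \<longleftrightarrow>
    (\<forall>r R. 0 < r \<and> r < R powr (1 + \<Phi> R) \<and> R powr (1 + \<Phi> R) \<le> R \<and> R \<le> C1 \<and> R < 1 \<longrightarrow> Q r R)"
  by (auto simp: admissible_scales_def)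

lemma word_prod_cong:
  "(\<And>i. i < N \<Longrightarrow> i \<in> V \<longleftrightarrow> i \<in> W) \<Longrightarrow> word_prod f g V N = word_prod f g W N"
  unfolding word_prod_def by (rule prod.cong) auto

lemma left_end_cong:
  assumes "\<And>i. i < N \<Longrightarrow> i \<in> V \<longleftrightarrow> i \<in> W"
  shows "left_end a b V N = left_end a b W N"
  unfolding left_end_def
proof (rule sum.cong)
  fix i assume "i \<in> {..<N}"
  then show "(if i \<in> V then (1 - b i) * word_prod a b V i else 0) =
      (if i \<in> W then (1 - b i) * word_prod a b W i else 0)"
    using assms word_prod_cong[of i V W a b] by auto
qed simp

lemma left_end_stable:
  assumes "V \<subseteq> {..<K}" "K \<le> N"
  shows "left_end a b V N = left_end a b V K"
  unfolding left_end_def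
  by (rule sum.mono_neutral_right) (use assms in auto)

lemma word_prod_0 [simp]: "word_prod f g V 0 = 1"
  and left_end_0 [simp]: "left_end a b V 0 = 0"
  and word_prod_Suc: "word_prod f g V (Suc N) = word_prod f g V N * (if N \<in> V then g N else f N)"
  and left_end_Suc: "left_end a b V (Suc N) =
        left_end a b V N + (if N \<in> V then (1 - b N) * word_prod a b V N else 0)"
  by (auto simp: word_prod_def left_end_def)

locale moran_seq =
  fixes a b p :: "nat \<Rightarrow> real" and A B :: real
  assumes A_pos: "0 < A" and B_less: "B < 1"
    and a_ge: "A \<le> a i" and b_ge: "A \<le> b i" and ab_le: "a i + b i \<le> B"
    and p_pos: "0 < p i" and p_less: "p i < 1"
begin

abbreviation "len \<equiv> word_prod a b"
abbreviation "mass \<equiv> word_prod p (\<lambda>i. 1 - p i)"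
abbreviation "lft \<equiv> left_end a b"
abbreviation "cyl V N \<equiv> {lft V N..lft V N + len V N}"

lemma len_ge: "A ^ N \<le> len V N"
  unfolding word_prod_def
  using prod_mono[of "{..<N}" "\<lambda>_. A" "\<lambda>i. if i \<in> V then b i else a i"] A_pos a_ge b_ge by simp

lemma len_pos: "0 < len V N"
  using len_ge[of N V] A_pos by (meson order_less_le_trans zero_less_power)

lemma a_pos: "0 < a i" and b_pos: "0 < b i"
  using A_pos a_ge[of i] b_ge[of i] by auto

lemma len_le: "len V N \<le> B ^ N"
proof -
  have "0 \<le> (if i \<in> V then b i else a i) \<and> (if i \<in> V then b i else a i) \<le> B" for i
    using a_pos[of i] b_pos[of i] ab_le[of i] by auto
  then show ?thesis
    unfolding word_prod_def
    using prod_mono[of "{..<N}" "\<lambda>i. if i \<in> V then b i else a i" "\<lambda>_. B"] by simp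
qed

lemma B_nonneg: "0 \<le> B"
  using a_pos[of 0] b_pos[of 0] ab_le[of 0] by linarith

lemma mass_pos: "0 < mass V N"
  unfolding word_prod_def using p_pos p_less by (intro prod_pos) auto

lemma mass_le: "mass V N \<le> (\<Prod>i<N. max (p i) (1 - p i))"
  unfolding word_prod_def using p_pos p_less by (intro prod_mono) (auto simp: less_imp_le)

lemma cyl_Suc_subset: "cyl V (Suc N) \<subseteq> cyl V N"
proof -
  have 1: "a N * len V N \<le> len V N"
    using mult_right_mono[of "a N" 1 "len V N"] len_pos[of V N] ab_le[of N] b_pos[of N] B_less by auto
  have 2: "b N * len V N \<le> len V N"
    using mult_right_mono[of "b N" 1 "len V N"] len_pos[of V N] ab_le[of N] a_pos[of N] B_less by auto
  show ?thesis
    using 1 2 by (auto simp: word_prod_Suc left_end_Suc algebra_simps)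
qed

lemma cyl_antimono: "j \<le> N \<Longrightarrow> cyl V N \<subseteq> cyl V j"
  using lift_Suc_antimono_le[of "\<lambda>N. cyl V N" j N] cyl_Suc_subset by blast

text \<open>
  At the first step \<open>j\<close> where two words differ, they enter the two children of one interval, which
  are separated by the fraction \<open>1 - a j - b j \<ge> 1 - B\<close> of its length.
\<close>
lemma cyl_separation_at_first_difference:
  assumes "j \<in> V" "j \<notin> W" "\<And>i. i < j \<Longrightarrow> i \<in> V \<longleftrightarrow> i \<in> W"
    and "j < N" "j < N'" "x \<in> cyl V N" "y \<in> cyl W N'"
  shows "(1 - B) * A ^ j \<le> x - y"
proof -
  have x: "x \<in> cyl V (Suc j)" using cyl_antimono[of "Suc j" N V] assms by (meson Suc_leI subsetD)
  have y: "y \<in> cyl W (Suc j)" using cyl_antimono[of "Suc j" N' W] assms by (meson Suc_leI subsetD)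
  have eq: "len W j = len V j" "lft W j = lft V j"
    using assms(3) by (simp_all add: word_prod_cong[of j W V] left_end_cong[of j W V])
  have "(1 - B) * A ^ j \<le> (1 - a j - b j) * len V j"
    using ab_le[of j] len_ge[of j V] A_pos B_less by (intro mult_mono) auto
  also have "\<dots> \<le> x - y"
    using x y assms(1,2) eq by (auto simp: word_prod_Suc left_end_Suc algebra_simps)
  finally show ?thesis .
qed

lemma cyl_separation:
  assumes "\<exists>i<k. (i \<in> V) \<noteq> (i \<in> W)" "k \<le> N" "k \<le> N'" "x \<in> cyl V N" "y \<in> cyl W N'"
  shows "(1 - B) * A ^ k \<le> \<bar>x - y\<bar>"
proof -
  define j where "j = (LEAST i. (i \<in> V) \<noteq> (i \<in> W))"
  obtain i where i: "i < k" "(i \<in> V) \<noteq> (i \<in> W)" using assms(1) by blast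
  have j: "(j \<in> V) \<noteq> (j \<in> W)" unfolding j_def by (rule LeastI[of _ i]) (rule i)
  have jk: "j < k" unfolding j_def using Least_le[of "\<lambda>i. (i \<in> V) \<noteq> (i \<in> W)" i] i by linarith
  have before: "i \<in> V \<longleftrightarrow> i \<in> W" if "i < j" for i
    using not_less_Least[of i "\<lambda>i. (i \<in> V) \<noteq> (i \<in> W)"] that unfolding j_def by blast
  have "A \<le> 1" using a_ge[of 0] b_pos[of 0] ab_le[of 0] B_less by linarith
  then have "A ^ k \<le> A ^ j" using jk A_pos by (intro power_decreasing) auto
  then have "(1 - B) * A ^ k \<le> (1 - B) * A ^ j" using B_less by (intro mult_left_mono) auto
  also have "\<dots> \<le> \<bar>x - y\<bar>"
  proof (cases "j \<in> V")
    case True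
    then have "(1 - B) * A ^ j \<le> x - y"
      using j jk before assms by (intro cyl_separation_at_first_difference[of j V W N N']) auto
    then show ?thesis by linarith
  next
    case False
    then have "(1 - B) * A ^ j \<le> y - x"
      using j jk before assms by (intro cyl_separation_at_first_difference[of j W V N' N]) auto
    then show ?thesis by linarith
  qed
  finally show ?thesis .
qed

lemma lft_in_cyl: "lft V N \<in> cyl V N"
  using len_pos[of V N] by simp

lemma words_eq_of_common_point:
  assumes "x \<in> cyl V N" "x \<in> cyl W N" "i < N"
  shows "i \<in> V \<longleftrightarrow> i \<in> W"
proof (rule ccontr)
  assume "(i \<in> V) \<noteq> (i \<in> W)"
  then have "(1 - B) * A ^ N \<le> \<bar>x - x\<bar>"
    using assms by (intro cyl_separation[of N V W N N]) auto
  then show False using zero_less_power[OF A_pos, of N] B_less by (simp add: mult_le_0_iff)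
qed

lemma cyl_shrink:
  assumes "e > 0"
  shows "\<exists>N\<ge>K. B ^ N < e"
proof -
  have "(\<lambda>N. B ^ N) \<longlonglongrightarrow> 0" using B_nonneg B_less by (intro LIMSEQ_realpow_zero)
  then obtain N where N: "\<And>n. n \<ge> N \<Longrightarrow> B ^ n < e"
    using order_tendstoD(2)[of _ 0 sequentially e] assms by (auto simp: eventually_sequentially)
  then show ?thesis by (intro exI[of _ "max K N"]) auto
qed

end

section \<open>The Moran measure of a ball\<close>

text \<open>
  The sequences \<open>\<alpha>\<close>, \<open>\<beta>\<close>, \<open>\<gamma>\<close> are numbered from \<open>1\<close> as in the definition of Moran intervals, while
  words are sets of naturals from \<open>0\<close>; the equations shift one numbering to the other.
\<close>

locale moran_measure = moran_seq +
  fixes \<alpha> \<beta> \<gamma> :: "nat \<Rightarrow> real" and \<mu> :: "real measure"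
  assumes a_eq: "a i = \<alpha> (Suc i)" and b_eq: "b i = \<beta> (Suc i)" and p_eq: "p i = \<gamma> (Suc i)"
    and moran: "is_moran_measure \<alpha> \<beta> \<gamma> \<mu>"
begin

sublocale real_distribution \<mu>
  using moran by (simp add: is_moran_measure_def real_distribution_def real_distribution_axioms_def)

lemma cyl_is_moran_interval: "(lft V N, lft V N + len V N) \<in> moran_intervals \<alpha> \<beta> N"
proof (induction N)
  case (Suc N)
  show ?case
    unfolding moran_intervals.simps
    by (rule UN_I[OF Suc])
      (auto simp: word_prod_Suc left_end_Suc a_eq[symmetric] b_eq[symmetric] algebra_simps)
qed simp

lemma moran_interval_is_cyl:
  "(l, r) \<in> moran_intervals \<alpha> \<beta> N \<Longrightarrow> \<exists>V\<in>Pow {..<N}. l = lft V N \<and> r = lft V N + len V N"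
proof (induction N arbitrary: l r)
  case (Suc N)
  then obtain l' r' where lr: "(l', r') \<in> moran_intervals \<alpha> \<beta> N"
    "(l, r) = (l', l' + \<alpha> (Suc N) * (r' - l')) \<or> (l, r) = (r' - \<beta> (Suc N) * (r' - l'), r')"
    by auto
  obtain V where V: "V \<subseteq> {..<N}" "l' = lft V N" "r' = lft V N + len V N"
    using Suc.IH[OF lr(1)] by auto
  from lr(2) show ?case
  proof
    assume "(l, r) = (l', l' + \<alpha> (Suc N) * (r' - l'))"
    moreover have "N \<notin> V" using V(1) by auto
    ultimately show ?thesis
      using V by (intro bexI[of _ V]) (auto simp: word_prod_Suc left_end_Suc a_eq[symmetric] algebra_simps)
  next
    assume *: "(l, r) = (r' - \<beta> (Suc N) * (r' - l'), r')"
    have "len (insert N V) N = len V N" "lft (insert N V) N = lft V N"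
      by (auto intro: word_prod_cong left_end_cong)
    then show ?thesis
      using V * by (intro bexI[of _ "insert N V"])
        (auto simp: word_prod_Suc left_end_Suc b_eq[symmetric] algebra_simps)
  qed
qed simp

lemma measure_cyl: "measure \<mu> (cyl V N) = mass V N"
proof (induction N)
  case 0
  then show ?case using moran by (simp add: is_moran_measure_def)
next
  case (Suc N)
  let ?l = "lft V N" and ?r = "lft V N + len V N"
  have "measure \<mu> {?l..?l + \<alpha> (Suc N) * (?r - ?l)} = \<gamma> (Suc N) * measure \<mu> {?l..?r}"
    "measure \<mu> {?r - \<beta> (Suc N) * (?r - ?l)..?r} = (1 - \<gamma> (Suc N)) * measure \<mu> {?l..?r}"
    using moran cyl_is_moran_interval[of V N] unfolding is_moran_measure_def by blast+
  then show ?case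
    using Suc by (cases "N \<in> V")
      (simp_all add: word_prod_Suc left_end_Suc a_eq[symmetric] b_eq[symmetric] p_eq[symmetric] algebra_simps)
qed

abbreviation "C \<equiv> moran_set \<alpha> \<beta>"

lemma C_cyl: "x \<in> C \<Longrightarrow> \<exists>V\<in>Pow {..<N}. x \<in> cyl V N"
  unfolding moran_set_def using moran_interval_is_cyl[of _ _ N] by fastforce

lemma prob_C: "prob C = 1"
  using moran by (simp add: is_moran_measure_def)

lemma C_sets: "C \<in> sets \<mu>"
  using prob_C measure_notin_sets[of C \<mu>] by fastforce

lemma prob_Int_C: "Y \<in> sets \<mu> \<Longrightarrow> prob (Y \<inter> C) = prob Y"
  using measure_space_inter[of Y C] prob_C prob_space C_sets by simp

text \<open>
  The Moran set inside the ball is the increasing union of its intersections with the level \<open>N\<close>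
  intervals contained in the ball, as the interval around a point shrinks into any neighbourhood.
  Intersecting with the Moran set is essential for monotonicity: an interval of level \<open>N\<close> is not
  the union of its children.
\<close>
lemma inner_mass_tendsto:
  "inner_mass a b p x r \<longlonglongrightarrow> prob (ball x r)"
proof -
  define Q where "Q V N \<longleftrightarrow> x - r < lft V N \<and> lft V N + len V N < x + r" for V N
  define U where "U N = (\<Union>V\<in>{V \<in> Pow {..<N}. Q V N}. cyl V N)" for N
  have Q: "Q V N \<longleftrightarrow> cyl V N \<subseteq> ball x r" for V N
  proof
    assume "cyl V N \<subseteq> ball x r"
    moreover have "lft V N \<in> cyl V N" "lft V N + len V N \<in> cyl V N"
      using len_pos[of V N] by auto
    ultimately have "lft V N \<in> ball x r" "lft V N + len V N \<in> ball x r" by blast+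
    then show "Q V N" by (simp add: Q_def ball_eq_greaterThanLessThan)
  qed (auto simp: Q_def ball_eq_greaterThanLessThan)
  have U_sets: "U N \<in> sets \<mu>" for N
    unfolding U_def by (intro sets.finite_UN) auto
  have "prob (U N) = inner_mass a b p x r N" for N
  proof -
    have "disjoint_family_on (\<lambda>V. cyl V N) {V \<in> Pow {..<N}. Q V N}"
      unfolding disjoint_family_on_def using words_eq_of_common_point by blast
    then have "prob (U N) = (\<Sum>V\<in>{V \<in> Pow {..<N}. Q V N}. prob (cyl V N))"
      unfolding U_def by (intro finite_measure_finite_Union) auto
    then show ?thesis
      by (simp only: measure_cyl sum.inter_filter finite_Pow_iff finite_lessThan inner_mass_def Q_def)
  qed
  moreover have "(\<lambda>N. prob (U N \<inter> C)) \<longlonglongrightarrow> prob (\<Union>N. U N \<inter> C)"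
  proof (rule finite_Lim_measure_incseq)
    show "incseq (\<lambda>N. U N \<inter> C)"
    proof (rule incseq_SucI, rule subsetI)
      fix N y assume y: "y \<in> U N \<inter> C"
      then obtain V where V: "V \<subseteq> {..<N}" "Q V N" "y \<in> cyl V N" by (auto simp: U_def)
      obtain W where W: "W \<in> Pow {..<Suc N}" "y \<in> cyl W (Suc N)" using C_cyl y by blast
      then have "y \<in> cyl W N" using cyl_Suc_subset by blast
      then have "\<And>i. i < N \<Longrightarrow> i \<in> W \<longleftrightarrow> i \<in> V" using V words_eq_of_common_point by blast
      then have "cyl W N = cyl V N"
        using word_prod_cong[of N W V a b] left_end_cong[of N W V a b] by simp
      then have "Q W (Suc N)" using V(2) cyl_Suc_subset[of W N] unfolding Q by blast
      then show "y \<in> U (Suc N) \<inter> C" using W y by (auto simp: U_def)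
    qed
  qed (use U_sets C_sets in auto)
  moreover have "(\<Union>N. U N \<inter> C) = ball x r \<inter> C"
  proof
    show "(\<Union>N. U N \<inter> C) \<subseteq> ball x r \<inter> C" using Q by (auto simp: U_def)
    show "ball x r \<inter> C \<subseteq> (\<Union>N. U N \<inter> C)"
    proof
      fix y assume y: "y \<in> ball x r \<inter> C"
      then obtain e where e: "e > 0" "ball y e \<subseteq> ball x r"
        using openE[of "ball x r" y] by auto
      obtain N where N: "B ^ N < e" using cyl_shrink[OF e(1)] by blast
      obtain V where V: "V \<in> Pow {..<N}" "y \<in> cyl V N" using C_cyl y by blast
      have "cyl V N \<subseteq> ball y e"
        using V(2) len_le[of V N] N by (auto simp: ball_eq_greaterThanLessThan)
      then have "Q V N" using e Q by blast
      then show "y \<in> (\<Union>N. U N \<inter> C)" using V y by (auto simp: U_def)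
    qed
  qed
  ultimately show ?thesis using prob_Int_C U_sets by simp
qed

lemma ball_mass_eq: "ball_mass a b p x r = prob (ball x r)"
  unfolding ball_mass_def by (rule limI[OF inner_mass_tendsto])

abbreviation "left_points \<equiv> {lft V K | V K. V \<subseteq> {..<K}}"

text \<open>
  A left endpoint remains the left endpoint of ever smaller intervals of positive mass.
\<close>
lemma left_points_subset_support: "left_points \<subseteq> measure_support \<mu>"
proof clarify
  fix V :: "nat set" and K assume V: "V \<subseteq> {..<K}"
  show "lft V K \<in> measure_support \<mu>"
    unfolding measure_support_def
  proof (intro CollectI allI impI)
    fix U assume U: "open U \<and> lft V K \<in> U"
    then obtain e where e: "e > 0" "ball (lft V K) e \<subseteq> U" using openE by blast
    obtain N where N: "N \<ge> K" "B ^ N < e" using cyl_shrink[OF e(1)] by blast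
    have "cyl V N \<subseteq> ball (lft V K) e"
      using left_end_stable[OF V N(1)] len_le[of V N] N(2) by (auto simp: ball_eq_greaterThanLessThan)
    then have "mass V N \<le> prob U"
      using e U unfolding measure_cyl[symmetric] by (intro finite_measure_mono) auto
    then show "0 < emeasure \<mu> U"
      using mass_pos[of V N] by (simp add: emeasure_eq_measure)
  qed
qed

text \<open>
  A ball of positive mass contains a whole Moran interval by \<open>inner_mass_tendsto\<close>.
\<close>
lemma support_subset_closure_left_points: "measure_support \<mu> \<subseteq> closure left_points"
proof
  fix x assume x: "x \<in> measure_support \<mu>"
  show "x \<in> closure left_points"
    unfolding closure_approachable
  proof (intro allI impI)
    fix e :: real assume "e > 0"
    then have pos: "prob (ball x e) > 0"
      using x unfolding measure_support_def by (auto simp: emeasure_eq_measure)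
    have "\<exists>N. inner_mass a b p x e N \<noteq> 0"
    proof (rule ccontr)
      assume "\<not> ?thesis"
      then have "inner_mass a b p x e = (\<lambda>_. 0)" by auto
      then show False using inner_mass_tendsto[of x e] pos LIMSEQ_unique[OF tendsto_const] by fastforce
    qed
    then obtain N where N: "inner_mass a b p x e N \<noteq> 0" by blast
    then obtain V where "V \<in> Pow {..<N}" "(if x - e < lft V N \<and> lft V N + len V N < x + e
        then mass V N else 0) \<noteq> 0"
      unfolding inner_mass_def by (rule sum.not_neutral_contains_not_neutral)
    then have "V \<subseteq> {..<N}" "x - e < lft V N" "lft V N + len V N < x + e"
      by (auto split: if_splits)
    then show "\<exists>y\<in>left_points. dist y x < e"
      using len_pos[of V N] by (intro bexI[of _ "lft V N"]) (auto simp: dist_real_def)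
  qed
qed

lemma prob_ball_pos: "x \<in> measure_support \<mu> \<Longrightarrow> r > 0 \<Longrightarrow> 0 < prob (ball x r)"
  unfolding measure_support_def by (auto simp: emeasure_eq_measure)

lemma prob_singleton_eq_0:
  assumes "(\<lambda>N. \<Prod>i<N. max (p i) (1 - p i)) \<longlonglongrightarrow> 0"
  shows "prob {x} = 0"
proof (cases "x \<in> C")
  case True
  have "prob {x} \<le> (\<Prod>i<N. max (p i) (1 - p i))" for N
  proof -
    obtain V where "x \<in> cyl V N" using C_cyl True by blast
    then have "prob {x} \<le> prob (cyl V N)" by (intro finite_measure_mono) auto
    then show ?thesis using mass_le[of V N] by (simp add: measure_cyl)
  qed
  then have "prob {x} \<le> 0" using assms by (intro LIMSEQ_le_const) auto
  then show ?thesis by (simp add: measure_le_0_iff)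
next
  case False
  then show ?thesis using prob_Int_C[of "{x}"] by simp
qed

text \<open>
  Without atoms the distribution function is continuous, and the mass of a ball is a difference of
  two of its values.
\<close>
lemma tendsto_prob_ball:
  assumes "(\<lambda>N. \<Prod>i<N. max (p i) (1 - p i)) \<longlonglongrightarrow> 0"
    and "(f \<longlongrightarrow> x) F" "(g \<longlongrightarrow> r) F" "eventually (\<lambda>n. g n > 0) F" "r > 0"
  shows "((\<lambda>n. prob (ball (f n) (g n))) \<longlongrightarrow> prob (ball x r)) F"
proof -
  have cont: "isCont (cdf \<mu>) y" for y by (simp add: isCont_cdf prob_singleton_eq_0[OF assms(1)])
  have eq: "prob (ball y s) = cdf \<mu> (y + s) - cdf \<mu> (y - s)" if "s > 0" for y s
  proof -
    have "prob {y - s<..y + s} = prob ({y - s<..<y + s} \<union> {y + s})"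
      using that by (intro arg_cong[where f = prob]) auto
    also have "\<dots> = prob {y - s<..<y + s}"
      using prob_singleton_eq_0[OF assms(1)] by (subst finite_measure_Union) auto
    finally show ?thesis
      using cdf_diff_eq[of "y - s" "y + s"] that by (simp add: ball_eq_greaterThanLessThan)
  qed
  have "((\<lambda>n. cdf \<mu> (f n + g n) - cdf \<mu> (f n - g n)) \<longlongrightarrow> cdf \<mu> (x + r) - cdf \<mu> (x - r)) F"
    by (intro tendsto_diff isCont_tendsto_compose[OF cont] tendsto_add assms)
  then show ?thesis
    unfolding eq[OF \<open>r > 0\<close>]
    by (rule Lim_transform_eventually) (use assms(4) in \<open>auto elim!: eventually_mono simp: eq\<close>)
qed

section \<open>Dimension bounds as countably many conditions\<close>

text \<open>
  Without atoms both sides of the bound are continuous in \<open>(x, r, R)\<close> on the support times the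
  admissible scales, so the bound passes from the dense subset of left endpoints and scales in \<open>T\<close> to
  its closure.
\<close>

lemma coded_bound_iff:
  assumes diffuse: "(\<lambda>N. \<Prod>i<N. max (p i) (1 - p i)) \<longlonglongrightarrow> 0"
    and T: "T \<subseteq> admissible_scales \<Phi>" "admissible_scales \<Phi> \<subseteq> closure T"
  shows "coded_bound T \<sigma> d a b p \<longleftrightarrow>
    (\<exists>C1>0. \<exists>C2>0. \<forall>x\<in>measure_support \<mu>. \<forall>(r, R)\<in>admissible_scales \<Phi>. R \<le> C1 \<longrightarrow>
       (prob (ball x R) / prob (ball x r)) powr \<sigma> \<le> C2 * (R / r) powr (\<sigma> * d))"
    (is "_ \<longleftrightarrow> ?rhs")
proof
  assume "coded_bound T \<sigma> d a b p"
  then obtain n k :: nat where nk: "\<And>r R V K. \<lbrakk>(r, R) \<in> T; R < 1 / real (Suc n); V \<subseteq> {..<K}\<rbrakk> \<Longrightarrow>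
      (prob (ball (lft V K) R) / prob (ball (lft V K) r)) powr \<sigma>
         \<le> real (Suc k) * (R / r) powr (\<sigma> * d)"
    unfolding coded_bound_def ball_mass_eq by blast
  show ?rhs
  proof (intro exI conjI ballI)
    \<comment> \<open>The factor \<open>2\<close> makes \<open>R < 1 / Suc n\<close> hold strictly, hence for nearby scales as well.\<close>
    show "1 / (2 * real (Suc n)) > 0" "real (Suc k) > 0" by auto
    fix x q assume x: "x \<in> measure_support \<mu>" and q: "q \<in> admissible_scales \<Phi>"
    obtain r R where rR: "q = (r, R)" by (cases q)
    have pos: "0 < r" "0 < R" using q by (auto simp: rR admissible_scales_def)
    have "(prob (ball x R) / prob (ball x r)) powr \<sigma> \<le> real (Suc k) * (R / r) powr (\<sigma> * d)"
      if R: "R \<le> 1 / (2 * real (Suc n))"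
    proof -
      have "(x, q) \<in> closure (left_points \<times> T)"
        using x q support_subset_closure_left_points T(2) by (auto simp: closure_Times)
      then obtain z where z: "\<And>i. z i \<in> left_points \<times> T" "z \<longlonglongrightarrow> (x, q)"
        unfolding closure_sequential by blast
      define y where "y = (\<lambda>i. fst (z i))"
      define r' where "r' = (\<lambda>i. fst (snd (z i)))"
      define R' where "R' = (\<lambda>i. snd (snd (z i)))"
      have lims: "y \<longlonglongrightarrow> x" "r' \<longlonglongrightarrow> r" "R' \<longlonglongrightarrow> R"
        using tendsto_fst[OF z(2)] tendsto_fst[OF tendsto_snd[OF z(2)]] tendsto_snd[OF tendsto_snd[OF z(2)]]
        by (simp_all add: y_def r'_def R'_def rR)
      have in_sets: "y i \<in> left_points" "(r' i, R' i) \<in> T" for i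
        using z(1)[of i] unfolding mem_Times_iff y_def r'_def R'_def
        by (simp_all only: prod.collapse simp_thms)
      have pos': "0 < r' i" "0 < R' i" for i
        using in_sets(2)[of i] T(1) by (auto simp: admissible_scales_def)
      have "R < 1 / real (Suc n)" using R pos by (simp add: field_simps)
      with lims(3) have small: "eventually (\<lambda>i. R' i < 1 / real (Suc n)) sequentially"
        by (rule order_tendstoD)
      have "(\<lambda>i. (prob (ball (y i) (R' i)) / prob (ball (y i) (r' i))) powr \<sigma>) \<longlonglongrightarrow>
          (prob (ball x R) / prob (ball x r)) powr \<sigma>"
        using prob_ball_pos[OF x pos(1)] prob_ball_pos[OF x pos(2)] pos pos' lims
        by (intro tendsto_powr tendsto_divide tendsto_prob_ball[OF diffuse] tendsto_const) auto
      moreover have "(\<lambda>i. real (Suc k) * (R' i / r' i) powr (\<sigma> * d)) \<longlonglongrightarrow> real (Suc k) * (R / r) powr (\<sigma> * d)"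
        using pos lims by (intro tendsto_powr tendsto_divide tendsto_mult tendsto_const) auto
      moreover have "eventually (\<lambda>i. (prob (ball (y i) (R' i)) / prob (ball (y i) (r' i))) powr \<sigma>
           \<le> real (Suc k) * (R' i / r' i) powr (\<sigma> * d)) sequentially"
        using small
      proof (rule eventually_mono)
        fix i assume small: "R' i < 1 / real (Suc n)"
        obtain V K where VK: "y i = lft V K" "V \<subseteq> {..<K}" using in_sets(1)[of i] by auto
        show "(prob (ball (y i) (R' i)) / prob (ball (y i) (r' i))) powr \<sigma>
           \<le> real (Suc k) * (R' i / r' i) powr (\<sigma> * d)"
          using nk[OF in_sets(2) small VK(2)] by (simp only: VK(1))
      qed
      ultimately show ?thesis by (intro tendsto_le[OF sequentially_bot])
    qed
    then show "case q of (r, R) \<Rightarrow> R \<le> 1 / (2 * real (Suc n)) \<longrightarrow>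
        (prob (ball x R) / prob (ball x r)) powr \<sigma> \<le> real (Suc k) * (R / r) powr (\<sigma> * d)"
      by (simp add: rR)
  qed
next
  assume ?rhs
  then obtain C1 C2 where C: "C1 > 0" "\<And>x r R. \<lbrakk>x \<in> measure_support \<mu>; (r, R) \<in> admissible_scales \<Phi>; R \<le> C1\<rbrakk> \<Longrightarrow>
      (prob (ball x R) / prob (ball x r)) powr \<sigma> \<le> C2 * (R / r) powr (\<sigma> * d)"
    by blast
  obtain n where n: "1 / real (Suc n) < C1"
    using reals_Archimedean[OF C(1)] by (auto simp: inverse_eq_divide)
  obtain k where k: "C2 \<le> real k" using real_arch_simple by blast
  show "coded_bound T \<sigma> d a b p"
    unfolding coded_bound_def ball_mass_eq
  proof (rule exI[of _ n], rule exI[of _ k], clarify)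
    fix r R K and V :: "nat set" assume q: "(r, R) \<in> T" "R < 1 / real (Suc n)" "V \<subseteq> {..<K}"
    have "(prob (ball (lft V K) R) / prob (ball (lft V K) r)) powr \<sigma> \<le> C2 * (R / r) powr (\<sigma> * d)"
    proof (rule C(2))
      show "lft V K \<in> measure_support \<mu>" using q(3) left_points_subset_support by blast
    qed (use q n T(1) in auto)
    also have "\<dots> \<le> real (Suc k) * (R / r) powr (\<sigma> * d)"
      using k by (intro mult_right_mono) auto
    finally show "(prob (ball (lft V K) R) / prob (ball (lft V K) r)) powr \<sigma>
        \<le> real (Suc k) * (R / r) powr (\<sigma> * d)" .
  qed
qed

lemma upper_Phi_bound_iff_coded:
  assumes "(\<lambda>N. \<Prod>i<N. max (p i) (1 - p i)) \<longlonglongrightarrow> 0"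
    and "T \<subseteq> admissible_scales \<Phi>" "admissible_scales \<Phi> \<subseteq> closure T"
  shows "upper_Phi_bound \<Phi> \<mu> d \<longleftrightarrow> coded_bound T 1 d a b p"
  unfolding coded_bound_iff[OF assms] upper_Phi_bound_def ball_admissible_scales by simp

text \<open>
  All quantities are positive, so the lower bound is equivalent to the bound on the inverses.
\<close>
lemma lower_Phi_bound_iff_coded:
  assumes "(\<lambda>N. \<Prod>i<N. max (p i) (1 - p i)) \<longlonglongrightarrow> 0"
    and T: "T \<subseteq> admissible_scales \<Phi>" "admissible_scales \<Phi> \<subseteq> closure T"
  shows "lower_Phi_bound \<Phi> \<mu> d \<longleftrightarrow> coded_bound T (- 1) d a b p"
proof -
  have flip: "C * (R / r) powr d \<le> prob (ball x R) / prob (ball x r) \<longleftrightarrow>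
      (prob (ball x R) / prob (ball x r)) powr (- 1) \<le> inverse C * (R / r) powr (- 1 * d)"
    if "x \<in> measure_support \<mu>" "(r, R) \<in> admissible_scales \<Phi>" "C > 0" for x r R C
  proof -
    have "0 < r" "0 < R" using that by (auto simp: admissible_scales_def)
    then have "0 < prob (ball x R) / prob (ball x r)" "0 < C * (R / r) powr d"
      using prob_ball_pos that by auto
    moreover have "inverse C * (R / r) powr (- 1 * d) = inverse (C * (R / r) powr d)"
      by (simp add: powr_minus)
    ultimately show ?thesis
      by (simp add: powr_minus del: inverse_mult_distrib inverse_divide)
  qed
  have lower: "lower_Phi_bound \<Phi> \<mu> d \<longleftrightarrow> (\<exists>C1>0. \<exists>C2>0. \<forall>x\<in>measure_support \<mu>.
      \<forall>(r, R)\<in>admissible_scales \<Phi>. R \<le> C1 \<longrightarrow> C2 * (R / r) powr d \<le> prob (ball x R) / prob (ball x r))"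
    unfolding lower_Phi_bound_def ball_admissible_scales ..
  show ?thesis
  proof
    assume "lower_Phi_bound \<Phi> \<mu> d"
    then obtain C1 C2 where C: "C1 > 0" "C2 > 0" "\<And>x r R. \<lbrakk>x \<in> measure_support \<mu>;
        (r, R) \<in> admissible_scales \<Phi>; R \<le> C1\<rbrakk> \<Longrightarrow> C2 * (R / r) powr d \<le> prob (ball x R) / prob (ball x r)"
      unfolding lower by blast
    have "\<forall>x\<in>measure_support \<mu>. \<forall>(r, R)\<in>admissible_scales \<Phi>. R \<le> C1 \<longrightarrow>
        (prob (ball x R) / prob (ball x r)) powr (- 1) \<le> inverse C2 * (R / r) powr (- 1 * d)"
      using C(3) flip[OF _ _ C(2)] by blast
    then show "coded_bound T (- 1) d a b p"
      unfolding coded_bound_iff[OF assms]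
      using C(1) positive_imp_inverse_positive[OF C(2)] by blast
  next
    assume "coded_bound T (- 1) d a b p"
    then obtain C1 C2 where C: "C1 > 0" "C2 > 0" "\<And>x r R. \<lbrakk>x \<in> measure_support \<mu>;
        (r, R) \<in> admissible_scales \<Phi>; R \<le> C1\<rbrakk> \<Longrightarrow>
        (prob (ball x R) / prob (ball x r)) powr (- 1) \<le> C2 * (R / r) powr (- 1 * d)"
      unfolding coded_bound_iff[OF assms] by blast
    have pos: "inverse C2 > 0" using C(2) by simp
    have "\<forall>x\<in>measure_support \<mu>. \<forall>(r, R)\<in>admissible_scales \<Phi>. R \<le> C1 \<longrightarrow>
        inverse C2 * (R / r) powr d \<le> prob (ball x R) / prob (ball x r)"
      using C(3) flip[OF _ _ pos] unfolding inverse_inverse_eq by blast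
    then show "lower_Phi_bound \<Phi> \<mu> d"
      unfolding lower using C(1) pos by blast
  qed
qed

end

section \<open>Permuting the first steps of the construction\<close>

lemma vimage_permutes_agree:
  assumes "\<pi> permutes {..<m}"
  shows "(\<forall>i<m. i \<in> \<pi> -` V \<longleftrightarrow> i \<in> \<pi> -` W) \<longleftrightarrow> (\<forall>i<m. i \<in> V \<longleftrightarrow> i \<in> W)"
proof -
  have "(\<forall>i\<in>{..<m}. \<pi> i \<in> V \<longleftrightarrow> \<pi> i \<in> W) \<longleftrightarrow> (\<forall>i\<in>\<pi> ` {..<m}. i \<in> V \<longleftrightarrow> i \<in> W)" by blast
  then show ?thesis unfolding permutes_image[OF assms] by auto
qed

lemma word_prod_permute:
  assumes "\<pi> permutes {..<m}" "m \<le> N"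
  shows "word_prod (f \<circ> \<pi>) (g \<circ> \<pi>) (\<pi> -` V) N = word_prod f g V N"
proof -
  have "\<pi> permutes {..<N}" using assms by (intro permutes_subset[OF assms(1)]) auto
  from prod.permute[OF this, of "\<lambda>i. if i \<in> V then g i else f i"] show ?thesis
    by (simp add: word_prod_def comp_def)
qed

text \<open>
  If the permuted construction reads the word \<open>\<pi> -` V\<close>, it uses the same factors as the original one
  on \<open>V\<close>, in a different order. Below level \<open>m\<close> both add the same terms to the left endpoint, so the
  translation between the two intervals depends only on the first \<open>m\<close> letters of \<open>V\<close>.
\<close>
lemma left_end_permute:
  assumes \<pi>: "\<pi> permutes {..<m}" and "m \<le> N"
  shows "left_end (a \<circ> \<pi>) (b \<circ> \<pi>) (\<pi> -` V) N - left_end a b V N =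
    left_end (a \<circ> \<pi>) (b \<circ> \<pi>) (\<pi> -` V) m - left_end a b V m"
  using \<open>m \<le> N\<close>
proof (induction N rule: dec_induct)
  case (step N)
  have "\<pi> N = N" using permutes_not_in[OF \<pi>, of N] step.hyps by simp
  then show ?case
    using step word_prod_permute[OF \<pi> step.hyps(1), of a b V] by (simp add: left_end_Suc comp_def)
qed simp

context moran_seq
begin

lemma moran_seq_permute: "moran_seq (a \<circ> \<pi>) (b \<circ> \<pi>) (p \<circ> \<pi>) A B"
  using A_pos B_less a_ge b_ge ab_le p_pos p_less by unfold_locales auto

text \<open>
  For \<open>r \<le> (1 - B) * A ^ m\<close> only words that agree with \<open>W\<close> on the first \<open>m\<close> letters contribute, and
  their intervals are all moved by one common translation.
\<close>
lemma inner_mass_permute: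
  assumes \<pi>: "\<pi> permutes {..<m}" and W: "m \<le> K" "K \<le> N"
    and r: "r \<le> (1 - B) * A ^ m"
  shows "inner_mass (a \<circ> \<pi>) (b \<circ> \<pi>) (p \<circ> \<pi>) (left_end (a \<circ> \<pi>) (b \<circ> \<pi>) (\<pi> -` W) K) r N =
    inner_mass a b p (lft W K) r N"
proof -
  interpret perm: moran_seq "a \<circ> \<pi>" "b \<circ> \<pi>" "p \<circ> \<pi>" A B by (rule moran_seq_permute)
  have \<pi>N: "\<pi> permutes {..<N}" using W by (intro permutes_subset[OF \<pi>]) auto
  have "bij_betw (\<lambda>V. \<pi> -` V) (Pow {..<N}) (Pow {..<N})"
  proof (rule bij_betw_byWitness[where f' = "\<lambda>V. \<pi> ` V"])
    show "\<forall>V\<in>Pow {..<N}. \<pi> ` (\<pi> -` V) = V" using permutes_surj[OF \<pi>N] by (auto intro!: surj_image_vimage_eq)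
    show "\<forall>V\<in>Pow {..<N}. \<pi> -` (\<pi> ` V) = V" using permutes_inj[OF \<pi>N] by (auto intro!: inj_vimage_image_eq)
    show "(\<lambda>V. \<pi> -` V) ` Pow {..<N} \<subseteq> Pow {..<N}" using permutes_in_image[OF \<pi>N] by auto
    show "(\<lambda>V. \<pi> ` V) ` Pow {..<N} \<subseteq> Pow {..<N}" using permutes_in_image[OF \<pi>N] by auto
  qed
  note reindex = sum.reindex_bij_betw[OF this, symmetric]
  show ?thesis
    unfolding inner_mass_def
  proof (subst reindex, rule sum.cong[OF refl])
    fix V assume "V \<in> Pow {..<N}"
    have mN: "m \<le> N" using W by simp
    have len: "perm.len (\<pi> -` V) N = len V N" by (rule word_prod_permute[OF \<pi> mN])
    have mass: "perm.mass (\<pi> -` V) N = mass V N"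
      using word_prod_permute[OF \<pi> mN, of p "\<lambda>i. 1 - p i" V] by (simp add: comp_def)
    have "(perm.lft (\<pi> -` W) K - r < perm.lft (\<pi> -` V) N \<and>
           perm.lft (\<pi> -` V) N + perm.len (\<pi> -` V) N < perm.lft (\<pi> -` W) K + r) \<longleftrightarrow>
          (lft W K - r < lft V N \<and> lft V N + len V N < lft W K + r)"
    proof (cases "\<forall>i<m. i \<in> V \<longleftrightarrow> i \<in> W")
      case True
      have "lft V m = lft W m" using True by (intro left_end_cong) auto
      moreover have "perm.lft (\<pi> -` V) m = perm.lft (\<pi> -` W) m"
        using True vimage_permutes_agree[OF \<pi>, of V W] by (intro left_end_cong) blast
      ultimately have "perm.lft (\<pi> -` V) N - lft V N = perm.lft (\<pi> -` W) K - lft W K"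
        using left_end_permute[OF \<pi> mN, of a b V] left_end_permute[OF \<pi> W(1), of a b W] by simp
      then show ?thesis unfolding len by linarith
    next
      case False
      have "(1 - B) * A ^ m \<le> \<bar>lft V N - lft W K\<bar>"
        using False W mN by (intro cyl_separation[of m V W N K] lft_in_cyl) auto
      moreover have "(1 - B) * A ^ m \<le> \<bar>perm.lft (\<pi> -` V) N - perm.lft (\<pi> -` W) K\<bar>"
        using False W mN vimage_permutes_agree[OF \<pi>, of V W]
        by (intro perm.cyl_separation[of m "\<pi> -` V" "\<pi> -` W" N K] perm.lft_in_cyl) blast+
      ultimately show ?thesis
        using r len_pos[of V N] unfolding len by linarith
    qed
    then show "(if perm.lft (\<pi> -` W) K - r < perm.lft (\<pi> -` V) N \<and>
           perm.lft (\<pi> -` V) N + perm.len (\<pi> -` V) N < perm.lft (\<pi> -` W) K + r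
         then perm.mass (\<pi> -` V) N else 0) =
        (if lft W K - r < lft V N \<and> lft V N + len V N < lft W K + r then mass V N else 0)"
      unfolding mass by simp
  qed
qed

lemma ball_mass_permute:
  assumes \<pi>: "\<pi> permutes {..<m}" and W: "m \<le> K"
    and r: "r \<le> (1 - B) * A ^ m"
  shows "ball_mass (a \<circ> \<pi>) (b \<circ> \<pi>) (p \<circ> \<pi>) (left_end (a \<circ> \<pi>) (b \<circ> \<pi>) (\<pi> -` W) K) r =
    ball_mass a b p (lft W K) r"
proof -
  let ?f = "inner_mass (a \<circ> \<pi>) (b \<circ> \<pi>) (p \<circ> \<pi>) (left_end (a \<circ> \<pi>) (b \<circ> \<pi>) (\<pi> -` W) K) r"
  let ?g = "inner_mass a b p (lft W K) r"
  have "eventually (\<lambda>N. ?f N = ?g N) sequentially"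
    using eventually_ge_at_top[of K]
    by (rule eventually_mono) (rule inner_mass_permute[OF \<pi> W _ r])
  then have "?f \<longlonglongrightarrow> L \<longleftrightarrow> ?g \<longlonglongrightarrow> L" for L
    by (rule tendsto_cong)
  then show ?thesis by (simp add: ball_mass_def lim_def)
qed

lemma coded_bound_permute:
  assumes \<pi>: "\<pi> permutes {..<m}"
    and T: "\<And>r R. (r, R) \<in> T \<Longrightarrow> r \<le> R"
    and "coded_bound T \<sigma> d a b p"
  shows "coded_bound T \<sigma> d (a \<circ> \<pi>) (b \<circ> \<pi>) (p \<circ> \<pi>)"
proof -
  obtain n k :: nat where nk: "\<And>r R V K. \<lbrakk>(r, R) \<in> T; R < 1 / real (Suc n); V \<subseteq> {..<K}\<rbrakk> \<Longrightarrow>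
      (ball_mass a b p (lft V K) R / ball_mass a b p (lft V K) r) powr \<sigma>
         \<le> real (Suc k) * (R / r) powr (\<sigma> * d)"
    using assms(3) unfolding coded_bound_def by blast
  have "(1 - B) * A ^ m > 0" using A_pos B_less by simp
  then obtain n' where n': "1 / real (Suc n') < (1 - B) * A ^ m"
    using reals_Archimedean by (auto simp: inverse_eq_divide)
  let ?n = "max n n'"
  have mono: "1 / real (Suc ?n) \<le> 1 / real (Suc n)" "1 / real (Suc ?n) \<le> 1 / real (Suc n')"
    by (auto intro!: divide_left_mono)
  show ?thesis
    unfolding coded_bound_def
  proof (rule exI[of _ ?n], rule exI[of _ k], clarify)
    fix r R K and U :: "nat set" assume q: "(r, R) \<in> T" "R < 1 / real (Suc ?n)" "U \<subseteq> {..<K}"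
    \<comment> \<open>Words shorter than \<open>m\<close> are first extended by left turns, which keeps the left endpoint.\<close>
    define W L where "W = \<pi> ` U" and "L = max K m"
    have \<pi>L: "\<pi> permutes {..<L}" unfolding L_def by (intro permutes_subset[OF \<pi>]) auto
    have U: "U = \<pi> -` W"
      using permutes_inj[OF \<pi>] by (simp add: W_def inj_vimage_image_eq)
    have W: "W \<subseteq> {..<L}"
      using q(3) permutes_in_image[OF \<pi>L] by (auto simp: W_def L_def)
    have L: "m \<le> L" by (simp add: L_def)
    have small: "R \<le> (1 - B) * A ^ m" "r \<le> (1 - B) * A ^ m"
      using q(2) n' mono T[OF q(1)] by linarith+
    have eq: "left_end (a \<circ> \<pi>) (b \<circ> \<pi>) U K = left_end (a \<circ> \<pi>) (b \<circ> \<pi>) (\<pi> -` W) L"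
      unfolding U[symmetric] L_def using q(3) by (intro left_end_stable[symmetric]) auto
    show "(ball_mass (a \<circ> \<pi>) (b \<circ> \<pi>) (p \<circ> \<pi>) (left_end (a \<circ> \<pi>) (b \<circ> \<pi>) U K) R /
         ball_mass (a \<circ> \<pi>) (b \<circ> \<pi>) (p \<circ> \<pi>) (left_end (a \<circ> \<pi>) (b \<circ> \<pi>) U K) r) powr \<sigma>
      \<le> real (Suc k) * (R / r) powr (\<sigma> * d)"
      unfolding eq ball_mass_permute[OF \<pi> L small(1)] ball_mass_permute[OF \<pi> L small(2)]
      using q(2) mono by (intro nk[OF q(1) _ W]) linarith
  qed
qed

end

section \<open>Measurability of the coded bounds\<close>

abbreviation "left_ratio s \<equiv> \<lambda>i::nat. fst (s i :: real \<times> real \<times> real)"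
abbreviation "right_ratio s \<equiv> \<lambda>i::nat. fst (snd (s i :: real \<times> real \<times> real))"
abbreviation "left_weight s \<equiv> \<lambda>i::nat. snd (snd (s i :: real \<times> real \<times> real))"

text \<open>
  The conditions on the ratios and weights are part of the event, so that it is invariant under
  permutations at every point and not only almost surely.
\<close>
definition coded_event ::
  "real \<Rightarrow> real \<Rightarrow> (real \<times> real) set \<Rightarrow> real \<Rightarrow> real \<Rightarrow> (nat \<Rightarrow> real \<times> real \<times> real) set" where
  "coded_event A B T \<sigma> d =
    {s. moran_seq (left_ratio s) (right_ratio s) (left_weight s) A B \<and> coded_bound T \<sigma> d (left_ratio s) (right_ratio s) (left_weight s)}"

lemma coded_event_permute:
  assumes "\<pi> permutes {..<m}" and T: "\<And>r R. (r, R) \<in> T \<Longrightarrow> r \<le> R"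
  shows "s \<circ> \<pi> \<in> coded_event A B T \<sigma> d \<longleftrightarrow> s \<in> coded_event A B T \<sigma> d"
proof -
  have one: "s \<circ> \<pi> \<in> coded_event A B T \<sigma> d"
    if "\<pi> permutes {..<m}" "s \<in> coded_event A B T \<sigma> d" for s \<pi>
  proof -
    interpret moran_seq "left_ratio s" "right_ratio s" "left_weight s" A B using that by (simp add: coded_event_def)
    show ?thesis
      using moran_seq_permute[of \<pi>] coded_bound_permute[OF that(1), of T \<sigma> d] T that(2)
      by (simp add: coded_event_def comp_def)
  qed
  have "s = (s \<circ> \<pi>) \<circ> inv \<pi>"
    using permutes_inv_o(1)[OF assms(1)] by (simp add: comp_assoc)
  then show ?thesis
    using one[OF assms(1)] one[OF permutes_inv[OF assms(1)]] by metis
qed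

lemma coded_event_sets:
  assumes "countable T"
  shows "coded_event A B T \<sigma> d \<in> sets (PiM UNIV (\<lambda>_. borel))"
proof -
  let ?P = "PiM UNIV (\<lambda>_::nat. borel :: (real \<times> real \<times> real) measure)"
  have comp: "(\<lambda>s. s i) \<in> measurable ?P (borel \<Otimes>\<^sub>M (borel \<Otimes>\<^sub>M borel))" for i
    using measurable_component_singleton[of i UNIV "\<lambda>_. borel :: (real \<times> real \<times> real) measure"]
    by (simp add: borel_prod)
  have [measurable]: "(\<lambda>s. left_ratio s i) \<in> borel_measurable ?P" "(\<lambda>s. right_ratio s i) \<in> borel_measurable ?P"
      "(\<lambda>s. left_weight s i) \<in> borel_measurable ?P" for i
    using comp[of i] by measurable
  have wp [measurable]: "(\<lambda>s. word_prod (left_ratio s) (right_ratio s) V N) \<in> borel_measurable ?P"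
    "(\<lambda>s. word_prod (left_weight s) (\<lambda>i. 1 - left_weight s i) V N) \<in> borel_measurable ?P" for V N
    unfolding word_prod_def by measurable
  have le [measurable]: "(\<lambda>s. left_end (left_ratio s) (right_ratio s) V N) \<in> borel_measurable ?P" for V N
    unfolding left_end_def by measurable
  have [measurable]: "(\<lambda>s. inner_mass (left_ratio s) (right_ratio s) (left_weight s) (left_end (left_ratio s) (right_ratio s) V K) r N)
      \<in> borel_measurable ?P" for V K r N
    unfolding inner_mass_def by measurable
  have [measurable]: "(\<lambda>s. ball_mass (left_ratio s) (right_ratio s) (left_weight s) (left_end (left_ratio s) (right_ratio s) V K) r)
      \<in> borel_measurable ?P" for V K r
    unfolding ball_mass_def by measurable
  have [measurable]: "Measurable.pred ?P (\<lambda>s. moran_seq (left_ratio s) (right_ratio s) (left_weight s) A B)"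
    unfolding moran_seq_def by measurable
  have [measurable]: "Measurable.pred ?P (\<lambda>s. \<forall>q\<in>T. Q q s)" if "\<And>q. Measurable.pred ?P (Q q)" for Q
    using that assms unfolding pred_def by (intro sets.sets_Collect_countable_All')
  have [measurable]: "Measurable.pred ?P (\<lambda>s. coded_bound T \<sigma> d (left_ratio s) (right_ratio s) (left_weight s))"
    unfolding coded_bound_def split_beta by measurable
  have "{s \<in> space ?P. moran_seq (left_ratio s) (right_ratio s) (left_weight s) A B \<and>
      coded_bound T \<sigma> d (left_ratio s) (right_ratio s) (left_weight s)} \<in> sets ?P"
    by measurable
  then show ?thesis by (simp add: coded_event_def space_PiM)
qed

section \<open>Dimensions from rational exponents\<close>

lemma upper_Phi_bound_mono:
  assumes "upper_Phi_bound \<Phi> \<mu> d" "d \<le> d'"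
  shows "upper_Phi_bound \<Phi> \<mu> d'"
proof -
  obtain C1 C2 where C: "C1 > 0" "C2 > 0" "\<And>x r R. \<lbrakk>x \<in> measure_support \<mu>;
      0 < r \<and> r < R powr (1 + \<Phi> R) \<and> R powr (1 + \<Phi> R) \<le> R \<and> R \<le> C1 \<and> R < 1\<rbrakk> \<Longrightarrow>
      measure \<mu> (ball x R) / measure \<mu> (ball x r) \<le> C2 * (R / r) powr d"
    using assms(1) unfolding upper_Phi_bound_def by blast
  show ?thesis
    unfolding upper_Phi_bound_def
  proof (rule exI[of _ C1], rule conjI[OF C(1)], rule exI[of _ C2], rule conjI[OF C(2)], intro ballI allI impI)
    fix x r R assume x: "x \<in> measure_support \<mu>"
      and rR: "0 < r \<and> r < R powr (1 + \<Phi> R) \<and> R powr (1 + \<Phi> R) \<le> R \<and> R \<le> C1 \<and> R < 1"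
    have "measure \<mu> (ball x R) / measure \<mu> (ball x r) \<le> C2 * (R / r) powr d" by (rule C(3)[OF x rR])
    also have "\<dots> \<le> C2 * (R / r) powr d'"
      using rR C(2) assms(2) by (intro mult_left_mono powr_mono) auto
    finally show "measure \<mu> (ball x R) / measure \<mu> (ball x r) \<le> C2 * (R / r) powr d'" .
  qed
qed

lemma lower_Phi_bound_antimono:
  assumes "lower_Phi_bound \<Phi> \<mu> d" "d' \<le> d"
  shows "lower_Phi_bound \<Phi> \<mu> d'"
proof -
  obtain C1 C2 where C: "C1 > 0" "C2 > 0" "\<And>x r R. \<lbrakk>x \<in> measure_support \<mu>;
      0 < r \<and> r < R powr (1 + \<Phi> R) \<and> R powr (1 + \<Phi> R) \<le> R \<and> R \<le> C1 \<and> R < 1\<rbrakk> \<Longrightarrow>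
      measure \<mu> (ball x R) / measure \<mu> (ball x r) \<ge> C2 * (R / r) powr d"
    using assms(1) unfolding lower_Phi_bound_def by blast
  show ?thesis
    unfolding lower_Phi_bound_def
  proof (rule exI[of _ C1], rule conjI[OF C(1)], rule exI[of _ C2], rule conjI[OF C(2)], intro ballI allI impI)
    fix x r R assume x: "x \<in> measure_support \<mu>"
      and rR: "0 < r \<and> r < R powr (1 + \<Phi> R) \<and> R powr (1 + \<Phi> R) \<le> R \<and> R \<le> C1 \<and> R < 1"
    have "C2 * (R / r) powr d' \<le> C2 * (R / r) powr d"
      using rR C(2) assms(2) by (intro mult_left_mono powr_mono) auto
    also have "\<dots> \<le> measure \<mu> (ball x R) / measure \<mu> (ball x r)" by (rule C(3)[OF x rR])
    finally show "measure \<mu> (ball x R) / measure \<mu> (ball x r) \<ge> C2 * (R / r) powr d'" .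
  qed
qed

lemma upper_Phi_dim_rat:
  "upper_Phi_dim \<Phi> \<mu> = (INF q\<in>{q. upper_Phi_bound \<Phi> \<mu> (real_of_rat q)}. ereal (real_of_rat q))"
  unfolding upper_Phi_dim_def
proof (rule antisym)
  show "Inf (ereal ` {d. upper_Phi_bound \<Phi> \<mu> d}) \<le>
      (INF q\<in>{q. upper_Phi_bound \<Phi> \<mu> (real_of_rat q)}. ereal (real_of_rat q))"
    by (rule INF_greatest) (auto intro: INF_lower)
  show "(INF q\<in>{q. upper_Phi_bound \<Phi> \<mu> (real_of_rat q)}. ereal (real_of_rat q)) \<le>
      Inf (ereal ` {d. upper_Phi_bound \<Phi> \<mu> d})" (is "?I \<le> _")
  proof (rule INF_greatest)
    fix d assume d: "d \<in> {d. upper_Phi_bound \<Phi> \<mu> d}"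
    have le: "?I \<le> ereal e" if de: "d < e" for e
    proof -
      obtain q where q: "d < real_of_rat q" "real_of_rat q < e" using of_rat_dense[OF de] by blast
      then have "upper_Phi_bound \<Phi> \<mu> (real_of_rat q)"
        using d by (auto intro: upper_Phi_bound_mono)
      then have "?I \<le> ereal (real_of_rat q)" by (intro INF_lower) auto
      then show ?thesis using q(2) by (meson ereal_less_eq(3) less_imp_le order_trans)
    qed
    show "?I \<le> ereal d"
      by (rule ereal_le_epsilon2) (auto intro: le)
  qed
qed

lemma lower_Phi_dim_rat:
  "lower_Phi_dim \<Phi> \<mu> = (SUP q\<in>{q. lower_Phi_bound \<Phi> \<mu> (real_of_rat q)}. ereal (real_of_rat q))"
  unfolding lower_Phi_dim_def
proof (rule antisym)
  show "(SUP q\<in>{q. lower_Phi_bound \<Phi> \<mu> (real_of_rat q)}. ereal (real_of_rat q)) \<le>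
      Sup (ereal ` {d. lower_Phi_bound \<Phi> \<mu> d})"
    by (rule SUP_least) (auto intro: SUP_upper)
  show "Sup (ereal ` {d. lower_Phi_bound \<Phi> \<mu> d}) \<le>
      (SUP q\<in>{q. lower_Phi_bound \<Phi> \<mu> (real_of_rat q)}. ereal (real_of_rat q))" (is "_ \<le> ?I")
  proof (rule SUP_least)
    fix d assume d: "d \<in> {d. lower_Phi_bound \<Phi> \<mu> d}"
    show "ereal d \<le> ?I"
    proof (rule ereal_le_epsilon2)
      fix e :: real assume "0 < e"
      then have "d - e < d" by simp
      then obtain q where q: "d - e < real_of_rat q" "real_of_rat q < d" using of_rat_dense by blast
      then have "lower_Phi_bound \<Phi> \<mu> (real_of_rat q)"
        using d by (auto intro: lower_Phi_bound_antimono)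
      then have "ereal (real_of_rat q) \<le> ?I" by (intro SUP_upper) auto
      then have "ereal (real_of_rat q) + ereal e \<le> ?I + ereal e" by (rule add_right_mono)
      moreover have "ereal d \<le> ereal (real_of_rat q) + ereal e" using q(1) by simp
      ultimately show "ereal d \<le> ?I + ereal e" by (rule order_trans[rotated])
    qed
  qed
qed

section \<open>Nonnegativity of the dimensions\<close>

text \<open>
  Otherwise countably many open null sets would cover the line, by the Lindelof property.
\<close>
lemma (in real_distribution) measure_support_nonempty: "measure_support M \<noteq> {}"
proof
  assume empty: "measure_support M = {}"
  let ?F = "{U :: real set. open U \<and> emeasure M U = 0}"
  have "\<Union> ?F = UNIV"
    using empty unfolding measure_support_def by (auto simp: set_eq_iff)
  moreover obtain F' where F': "F' \<subseteq> ?F" "countable F'" "\<Union> F' = \<Union> ?F"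
    using Lindelof[of ?F] by auto
  moreover have "(\<Union>U\<in>F'. U) \<in> null_sets M"
    using F' by (intro null_sets_UN') (auto simp: null_sets_def)
  ultimately have "emeasure M UNIV = 0" by (simp add: null_sets_def)
  then show False using emeasure_space_1 by simp
qed

lemma (in real_distribution) ball_ratio_ge_1:
  assumes "x \<in> measure_support M" "0 < r" "r \<le> R"
  shows "1 \<le> prob (ball x R) / prob (ball x r)"
proof -
  have "0 < prob (ball x r)"
    using assms unfolding measure_support_def by (auto simp: emeasure_eq_measure)
  moreover have "prob (ball x r) \<le> prob (ball x R)"
    using assms by (intro finite_measure_mono) auto
  ultimately show ?thesis by simp
qed

lemma (in real_distribution) lower_Phi_dim_nonneg: "0 \<le> lower_Phi_dim \<Phi> M"
proof -
  have "lower_Phi_bound \<Phi> M 0"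
    unfolding lower_Phi_bound_def
    by (rule exI[of _ 1], rule conjI, simp, rule exI[of _ 1], rule conjI, simp)
      (auto intro!: ball_ratio_ge_1)
  then have "ereal 0 \<le> lower_Phi_dim \<Phi> M"
    unfolding lower_Phi_dim_def by (intro Sup_upper) auto
  then show ?thesis by (simp add: zero_ereal_def)
qed

text \<open>
  The quotient of ball masses is at least \<open>1\<close>, whereas for \<open>d < 0\<close> and fixed \<open>R\<close> the bound
  \<open>C2 * (R / r) powr d\<close> tends to \<open>0\<close> with \<open>r\<close>.
\<close>
lemma (in real_distribution) upper_Phi_dim_nonneg:
  assumes "dimension_function \<Phi>"
  shows "0 \<le> upper_Phi_dim \<Phi> M"
proof -
  have "0 \<le> d" if bound: "upper_Phi_bound \<Phi> M d" for d
  proof (rule ccontr)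
    assume "\<not> 0 \<le> d"
    then have d: "0 < - d" by simp
    obtain C1 C2 where C: "C1 > 0" "C2 > 0" "\<And>x r R. \<lbrakk>x \<in> measure_support M;
        0 < r \<and> r < R powr (1 + \<Phi> R) \<and> R powr (1 + \<Phi> R) \<le> R \<and> R \<le> C1 \<and> R < 1\<rbrakk> \<Longrightarrow>
        prob (ball x R) / prob (ball x r) \<le> C2 * (R / r) powr d"
      using bound unfolding upper_Phi_bound_def by blast
    define R where "R = min C1 (1 / 2)"
    have R: "0 < R" "R \<le> C1" "R < 1" using C(1) by (auto simp: R_def)
    then have "0 \<le> \<Phi> R" using assms by (auto simp: dimension_function_def)
    then have "R powr (1 + \<Phi> R) \<le> R powr 1" using R by (intro powr_mono') auto
    then have R': "R powr (1 + \<Phi> R) \<le> R" using R by simp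
    obtain x where x: "x \<in> measure_support M" using measure_support_nonempty by blast
    have "((\<lambda>r. r / R) \<longlongrightarrow> 0 / R) (at_right 0)"
      using R by (intro tendsto_divide tendsto_ident_at tendsto_const) auto
    then have "((\<lambda>r. (r / R) powr (- d)) \<longlongrightarrow> 0) (at_right 0)"
      using R d by (intro tendsto_zero_powrI[where b = "- d"]) (auto simp: eventually_at_right_less eventually_at_filter)
    then have "((\<lambda>r. C2 * (r / R) powr (- d)) \<longlongrightarrow> C2 * 0) (at_right 0)"
      by (intro tendsto_mult tendsto_const)
    then have "eventually (\<lambda>r. C2 * (r / R) powr (- d) < 1) (at_right 0)"
      by (rule order_tendstoD) simp
    moreover have "eventually (\<lambda>r. 0 < r \<and> r < R powr (1 + \<Phi> R)) (at_right 0)"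
      using R eventually_at_right[of 0 "R powr (1 + \<Phi> R)"] by (auto simp: eventually_at_right_field intro!: exI[of _ "R powr (1 + \<Phi> R)"])
    ultimately have "eventually (\<lambda>r. C2 * (r / R) powr (- d) < 1 \<and> 0 < r \<and> r < R powr (1 + \<Phi> R)) (at_right 0)"
      by (rule eventually_conj)
    then obtain r where r: "C2 * (r / R) powr (- d) < 1" "0 < r" "r < R powr (1 + \<Phi> R)"
      using eventually_happens'[OF trivial_limit_at_right_real] by blast
    have "1 \<le> prob (ball x R) / prob (ball x r)"
      using r R' by (intro ball_ratio_ge_1[OF x]) auto
    also have "\<dots> \<le> C2 * (R / r) powr d" using r R R' by (intro C(3)[OF x]) auto
    also have "(R / r) powr d = (r / R) powr (- d)"
      using r R by (simp add: powr_divide powr_minus field_simps)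
    finally show False using r(1) by simp
  qed
  then show ?thesis
    unfolding upper_Phi_dim_def by (intro INF_greatest) (auto simp: zero_ereal_def)
qed

section \<open>Almost sure regularity of the weights\<close>

text \<open>
  The expectations of the partial products form a convergent geometric series, so almost surely the
  partial products are summable.
\<close>
lemma (in prob_space) AE_prod_tendsto_0:
  fixes Z :: "nat \<Rightarrow> 'a \<Rightarrow> real"
  assumes indep: "indep_vars (\<lambda>_. borel) Z {1..}"
    and ident: "\<And>n. n \<ge> 1 \<Longrightarrow> distr M borel (Z n) = distr M borel (Z 1)"
    and nonneg: "\<And>n \<omega>. 0 \<le> Z n \<omega>" and less: "AE \<omega> in M. Z 1 \<omega> < 1"
  shows "AE \<omega> in M. (\<lambda>N. \<Prod>i<N. Z (Suc i) \<omega>) \<longlonglongrightarrow> 0"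
proof -
  have Z [measurable]: "Z n \<in> borel_measurable M" if "n \<ge> 1" for n
    using indep that by (simp add: indep_vars_def)
  have int: "integrable M (Z 1)"
    using less nonneg Z by (intro integrable_const_bound[where B = 1]) (auto elim!: eventually_mono)
  define q where "q = expectation (Z 1)"
  have q: "0 \<le> q" "q < 1"
    using expectation_less[OF int less] nonneg by (auto simp: q_def)
  have "(\<integral>\<^sup>+\<omega>. ennreal (Z n \<omega>) \<partial>M) = ennreal q" if "n \<ge> 1" for n
  proof -
    have "(\<integral>\<^sup>+\<omega>. ennreal (Z n \<omega>) \<partial>M) = (\<integral>\<^sup>+x. ennreal x \<partial>distr M borel (Z n))"
      using Z that by (subst nn_integral_distr) auto
    also have "\<dots> = (\<integral>\<^sup>+\<omega>. ennreal (Z 1 \<omega>) \<partial>M)"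
      unfolding ident[OF that] using Z by (subst nn_integral_distr) auto
    also have "\<dots> = ennreal q"
      unfolding q_def using int nonneg by (intro nn_integral_eq_integral) auto
    finally show ?thesis .
  qed
  moreover have "(\<integral>\<^sup>+\<omega>. (\<Prod>n\<in>{1..N}. ennreal (Z n \<omega>)) \<partial>M) = (\<Prod>n\<in>{1..N}. \<integral>\<^sup>+\<omega>. ennreal (Z n \<omega>) \<partial>M)" for N
    by (rule indep_vars_nn_integral) (auto intro!: indep_vars_compose2[OF indep_vars_subset[OF indep]])
  ultimately have prod: "(\<integral>\<^sup>+\<omega>. ennreal (\<Prod>n\<in>{1..N}. Z n \<omega>) \<partial>M) = ennreal (q ^ N)" for N
    using nonneg q by (simp add: prod_ennreal ennreal_power)
  have "(\<integral>\<^sup>+\<omega>. (\<Sum>N. ennreal (\<Prod>n\<in>{1..N}. Z n \<omega>)) \<partial>M) =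
      (\<Sum>N. \<integral>\<^sup>+\<omega>. ennreal (\<Prod>n\<in>{1..N}. Z n \<omega>) \<partial>M)"
    using Z by (intro nn_integral_suminf) auto
  also have "\<dots> = (\<Sum>N. ennreal (q ^ N))" by (simp only: prod)
  also have "\<dots> = ennreal (\<Sum>N. q ^ N)"
    using q by (intro suminf_ennreal2 summable_geometric) auto
  finally have "(\<integral>\<^sup>+\<omega>. (\<Sum>N. ennreal (\<Prod>n\<in>{1..N}. Z n \<omega>)) \<partial>M) \<noteq> \<infinity>" by simp
  then have "AE \<omega> in M. (\<Sum>N. ennreal (\<Prod>n\<in>{1..N}. Z n \<omega>)) \<noteq> \<infinity>"
    using Z by (intro nn_integral_PInf_AE) auto
  then show ?thesis
  proof (rule eventually_mono)
    fix \<omega> assume "(\<Sum>N. ennreal (\<Prod>n\<in>{1..N}. Z n \<omega>)) \<noteq> \<infinity>"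
    then have "summable (\<lambda>N. \<Prod>n\<in>{1..N}. Z n \<omega>)"
      using nonneg by (intro summable_suminf_not_top) (auto intro: prod_nonneg)
    then have "(\<lambda>N. \<Prod>n\<in>{1..N}. Z n \<omega>) \<longlonglongrightarrow> 0" by (rule summable_LIMSEQ_zero)
    then show "(\<lambda>N. \<Prod>i<N. Z (Suc i) \<omega>) \<longlonglongrightarrow> 0"
      by (simp add: prod.atLeast1_atMost_eq)
  qed
qed

lemma AE_pos_of_neg_moment:
  assumes "X \<in> borel_measurable M" "neg_moment M X t < \<infinity>" "\<And>\<omega>. \<omega> \<in> space M \<Longrightarrow> 0 \<le> X \<omega>"
  shows "AE \<omega> in M. 0 < X \<omega>"
proof -
  have "AE \<omega> in M. inverse (ennreal (X \<omega> powr t)) \<noteq> \<infinity>"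
    using assms(1,2) unfolding neg_moment_def by (intro nn_integral_PInf_AE) auto
  then show ?thesis
    using AE_space
  proof eventually_elim
    case (elim \<omega>)
    then have "X \<omega> \<noteq> 0" by auto
    then show ?case using assms(3)[OF elim(2)] by simp
  qed
qed

section \<open>Almost sure constancy\<close>

text \<open>
  The events for \<open>\<sigma> = 1\<close> and \<open>\<sigma> = - 1\<close> agree with the upper and lower bounds outside one null set
  that does not depend on \<open>d\<close>; the zero-one law is then applied for each rational exponent.
\<close>
theorem proposition2:
  fixes M :: "'w measure" and A B t :: real
    and a b p :: "nat \<Rightarrow> 'w \<Rightarrow> real"
    and \<mu> :: "'w \<Rightarrow> real measure"
    and \<Phi> :: "real \<Rightarrow> real"
  assumes "prob_space M"
    and "0 < 2 * A" and "2 * A \<le> B" and "B < 1"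
    and indep: "prob_space.indep_vars M (\<lambda>_. borel)
      (\<lambda>n \<omega>. (a n \<omega>, b n \<omega>, p n \<omega>)) {1..}"
    and ident: "\<And>n. n \<ge> 1 \<Longrightarrow>
      distr M borel (\<lambda>\<omega>. (a n \<omega>, b n \<omega>, p n \<omega>)) =
      distr M borel (\<lambda>\<omega>. (a 1 \<omega>, b 1 \<omega>, p 1 \<omega>))"
    and range: "\<And>n \<omega>. n \<ge> 1 \<Longrightarrow> \<omega> \<in> space M \<Longrightarrow>
      (a n \<omega>, b n \<omega>, p n \<omega>) \<in>
        {(x, y, z). x \<in> {0..1} \<and> y \<in> {0..1} \<and> z \<in> {0..1} \<and>
          A \<le> min x y \<and> min x y < x + y \<and> x + y \<le> B}"
    and "t > 0"
    and "\<And>n. n \<ge> 1 \<Longrightarrow> neg_moment M (p n) t < \<infinity>"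
    and "\<And>n. n \<ge> 1 \<Longrightarrow> neg_moment M (\<lambda>\<omega>. 1 - p n \<omega>) t < \<infinity>"
    and moran: "\<And>\<omega>. \<omega> \<in> space M \<Longrightarrow>
      is_moran_measure (\<lambda>n. a n \<omega>) (\<lambda>n. b n \<omega>) (\<lambda>n. p n \<omega>) (\<mu> \<omega>)"
    and "dimension_function \<Phi>"
  shows "(\<forall>\<omega>\<in>space M. upper_Phi_dim \<Phi> (\<mu> \<omega>) \<ge> 0 \<and> lower_Phi_dim \<Phi> (\<mu> \<omega>) \<ge> 0) \<and>
    (\<exists>c. AE \<omega> in M. upper_Phi_dim \<Phi> (\<mu> \<omega>) = c) \<and>
    (\<exists>c. AE \<omega> in M. lower_Phi_dim \<Phi> (\<mu> \<omega>) = c)"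
proof -
  interpret prob_space M by fact
  define X where "X = (\<lambda>n \<omega>. (a n \<omega>, b n \<omega>, p n \<omega>))"
  have X: "X n \<in> borel_measurable M" if "n \<ge> 1" for n
    using indep that by (simp add: X_def indep_vars_def)
  have p_of_X: "(\<lambda>v :: real \<times> real \<times> real. snd (snd v)) \<in> borel_measurable borel"
    by (intro borel_measurable_continuous_onI continuous_intros)
  have p_meas: "p n \<in> borel_measurable M" if "n \<ge> 1" for n
    using measurable_compose[OF X[OF that] p_of_X] by (simp add: X_def)

  have "AE \<omega> in M. 0 < p n \<omega>" if "n \<ge> 1" for n
    using assms(9)[OF that] p_meas[OF that] range[OF that] by (intro AE_pos_of_neg_moment) auto
  moreover have "AE \<omega> in M. 0 < 1 - p n \<omega>" if "n \<ge> 1" for n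
    using assms(10)[OF that] p_meas[OF that] range[OF that]
    by (intro AE_pos_of_neg_moment[where X = "\<lambda>\<omega>. 1 - p n \<omega>"]) auto
  ultimately have p_inside: "AE \<omega> in M. 0 < p n \<omega> \<and> p n \<omega> < 1" if "n \<ge> 1" for n
    using that by fastforce
  then have p_all: "AE \<omega> in M. \<forall>i. 0 < p (Suc i) \<omega> \<and> p (Suc i) \<omega> < 1"
    by (subst AE_all_countable) simp

  define Z where "Z = (\<lambda>n \<omega>. max (p n \<omega>) (1 - p n \<omega>))"
  have h: "(\<lambda>v :: real \<times> real \<times> real. max (snd (snd v)) (1 - snd (snd v))) \<in> borel_measurable borel"
    using p_of_X by measurable
  have "indep_vars (\<lambda>_. borel) (\<lambda>n \<omega>. max (snd (snd (X n \<omega>))) (1 - snd (snd (X n \<omega>)))) {1..}"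
    using indep h unfolding X_def[symmetric] by (rule indep_vars_compose2)
  then have Z_indep: "indep_vars (\<lambda>_. borel) Z {1..}" by (simp add: X_def Z_def)
  have Z_ident: "distr M borel (Z n) = distr M borel (Z 1)" if "n \<ge> 1" for n
  proof -
    have "distr M borel (Z n) = distr (distr M borel (X n)) borel (\<lambda>v. max (snd (snd v)) (1 - snd (snd v)))"
      if "n \<ge> 1" for n
      using X[OF that] h by (subst distr_distr) (auto simp: comp_def X_def Z_def)
    moreover have "distr M borel (X n) = distr M borel (X 1)"
      using ident[OF \<open>n \<ge> 1\<close>] by (simp add: X_def)
    ultimately show ?thesis using \<open>n \<ge> 1\<close> by simp
  qed
  have Z_less: "AE \<omega> in M. Z 1 \<omega> < 1" using p_inside[of 1] by (auto simp: Z_def)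
  have diffuse: "AE \<omega> in M. (\<lambda>N. \<Prod>i<N. Z (Suc i) \<omega>) \<longlonglongrightarrow> 0"
    by (rule AE_prod_tendsto_0[OF Z_indep Z_ident _ Z_less]) (auto simp: Z_def)

  obtain T where T: "countable T" "T \<subseteq> admissible_scales \<Phi>" "admissible_scales \<Phi> \<subseteq> closure T"
    by (rule separable)
  have T_le: "r \<le> R" if "(r, R) \<in> T" for r R
    using T(2) that by (auto simp: admissible_scales_def)

  have const: "\<exists>c. \<forall>q. AE \<omega> in M.
      (\<lambda>i. X (Suc i) \<omega>) \<in> coded_event A B T \<sigma> (real_of_rat q) \<longleftrightarrow> c q" for \<sigma>
  proof (rule choice, rule allI, rule hewitt_savage_iid)
    show "indep_vars (\<lambda>_. borel) X {1..}" unfolding X_def by (rule indep)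
    show "distr M borel (X n) = distr M borel (X 1)" if "n \<ge> 1" for n
      unfolding X_def by (rule ident[OF that])
    show "coded_event A B T \<sigma> (real_of_rat q) \<in> sets (PiM UNIV (\<lambda>_. borel))" for q
      by (rule coded_event_sets[OF T(1)])
    show "s \<circ> \<pi> \<in> coded_event A B T \<sigma> (real_of_rat q) \<longleftrightarrow> s \<in> coded_event A B T \<sigma> (real_of_rat q)"
      if "\<pi> permutes {..<n}" for n \<pi> s q
      by (rule coded_event_permute[OF that T_le])
  qed simp
  have coded: "AE \<omega> in M. \<forall>d.
      (upper_Phi_bound \<Phi> (\<mu> \<omega>) d \<longleftrightarrow> (\<lambda>i. X (Suc i) \<omega>) \<in> coded_event A B T 1 d) \<and>
      (lower_Phi_bound \<Phi> (\<mu> \<omega>) d \<longleftrightarrow> (\<lambda>i. X (Suc i) \<omega>) \<in> coded_event A B T (- 1) d)"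
    using p_all diffuse AE_space
  proof eventually_elim
    case (elim \<omega>)
    interpret \<mu>: moran_measure "\<lambda>i. a (Suc i) \<omega>" "\<lambda>i. b (Suc i) \<omega>" "\<lambda>i. p (Suc i) \<omega>" A B
        "\<lambda>n. a n \<omega>" "\<lambda>n. b n \<omega>" "\<lambda>n. p n \<omega>" "\<mu> \<omega>"
    proof
      show "A \<le> a (Suc i) \<omega>" "A \<le> b (Suc i) \<omega>" "a (Suc i) \<omega> + b (Suc i) \<omega> \<le> B" for i
        using range[of "Suc i" \<omega>] elim(3) by auto
    qed (use assms(2,4) moran[OF elim(3)] elim(1) in auto)
    show ?case
      using \<mu>.upper_Phi_bound_iff_coded[OF _ T(2,3)] \<mu>.lower_Phi_bound_iff_coded[OF _ T(2,3)]
        elim(2) \<mu>.moran_seq_axioms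
      by (simp add: coded_event_def X_def Z_def)
  qed

  have "\<exists>c. AE \<omega> in M. upper_Phi_dim \<Phi> (\<mu> \<omega>) = c"
  proof -
    obtain c where "\<And>q. AE \<omega> in M.
        (\<lambda>i. X (Suc i) \<omega>) \<in> coded_event A B T 1 (real_of_rat q) \<longleftrightarrow> c q"
      using const[of 1] by blast
    then have "AE \<omega> in M. \<forall>q. (\<lambda>i. X (Suc i) \<omega>) \<in> coded_event A B T 1 (real_of_rat q) \<longleftrightarrow> c q"
      by (subst AE_all_countable) simp
    with coded have "AE \<omega> in M. upper_Phi_dim \<Phi> (\<mu> \<omega>) = (INF q\<in>{q. c q}. ereal (real_of_rat q))"
      unfolding upper_Phi_dim_rat by eventually_elim simp
    then show ?thesis by (rule exI)
  qed
  moreover have "\<exists>c. AE \<omega> in M. lower_Phi_dim \<Phi> (\<mu> \<omega>) = c"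
  proof -
    obtain c where "\<And>q. AE \<omega> in M.
        (\<lambda>i. X (Suc i) \<omega>) \<in> coded_event A B T (- 1) (real_of_rat q) \<longleftrightarrow> c q"
      using const[of "- 1"] by blast
    then have "AE \<omega> in M. \<forall>q. (\<lambda>i. X (Suc i) \<omega>) \<in> coded_event A B T (- 1) (real_of_rat q) \<longleftrightarrow> c q"
      by (subst AE_all_countable) simp
    with coded have "AE \<omega> in M. lower_Phi_dim \<Phi> (\<mu> \<omega>) = (SUP q\<in>{q. c q}. ereal (real_of_rat q))"
      unfolding lower_Phi_dim_rat by eventually_elim simp
    then show ?thesis by (rule exI)
  qed
  moreover have "upper_Phi_dim \<Phi> (\<mu> \<omega>) \<ge> 0 \<and> lower_Phi_dim \<Phi> (\<mu> \<omega>) \<ge> 0" if "\<omega> \<in> space M" for \<omega>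
  proof -
    interpret \<mu>: real_distribution "\<mu> \<omega>"
      using moran[OF that] by (simp add: is_moran_measure_def real_distribution_def real_distribution_axioms_def)
    show ?thesis using \<mu>.upper_Phi_dim_nonneg[OF assms(12)] \<mu>.lower_Phi_dim_nonneg by simp
  qed
  ultimately show ?thesis by blast
qed

end
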